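(* Let $f$ be a quadratic function in $n$ variables lying in the positive Erdahl cone $\mathcal{E}_{>0}$. Then $f$ is extreme if and only if $f$ is perfect and eutactic.
   Context: A quadratic function in $n$ variables is $f(x)=\alpha_f+2b_f\cdot x+Q_f[x]$ with $\alpha_f\in\mathbb{R}$, $b_f\in\mathbb{R}^n$, $Q_f$ a real symmetric $n\times n$ matrix, $Q[x]=x^tQx$. The space of quadratic functions (dimension $\binom{n+2}{2}$) has inner product $(f,g)=\alpha_f\alpha_g+2b_f\cdot b_g+\mathrm{tr}(Q_fQ_g)$. A symmetric matrix $M$ is identified with the quadratic function with $\alpha=0$, $b=0$, quadratic part $M$. For $x\in\mathbb{R}^n$, $\mathrm{ev}_x$ denotes the quadratic function $y\mapsto(1+x\cdot y)^2$ (so $(\mathrm{ev}_x,f)=f(x)$). The positive Erdahl cone is $\mathcal{E}_{>0}=\{f: f(v)\ge0 \text{ for all } v\in\mathbb{Z}^n,\ Q_f \text{ positive definite}\}$. For $f\in\mathcal{E}_{>0}$ let $\mu(f)=-\min_{x\in\mathbb{R}^n}f(x)$, $c_f=-Q_f^{-1}b_f$, $\mathrm{Del}\,f=\mathrm{conv}\{v\in\mathbb{Z}^n: f(v)=0\}$ with vertex set $\mathrm{vert}\,\mathrm{Del}\,f$, and Hermite invariant $H(f)=\mu(f)/(\det Q_f)^{1/n}$. $f$ is extreme if it is a local maximum of $H$ on $\mathcal{E}_{>0}$; perfect if $\{\mathrm{ev}_v: v\in\mathrm{vert}\,\mathrm{Del}\,f\}$ spans a space of dimension $\binom{n+2}{2}-1$;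 eutactic if there are positive reals $\alpha_v$, $v\in\mathrm{vert}\,\mathrm{Del}\,f$, with $\sum_v\alpha_v\mathrm{ev}_v=\mathrm{ev}_{c_f}+\frac{\mu(f)}{n}Q_f^{-1}$. *)

theory Defs
  imports "HOL-Analysis.Analysis"
begin

text \<open>
  A quadratic function \<open>x \<mapsto> \<alpha> + 2 b \<bullet> x + x\<^sup>t Q x\<close> in \<open>CARD('n)\<close> variables is represented by its
  coefficients \<open>(\<alpha>, b, Q)\<close>; only triples with symmetric \<open>Q\<close> (the set \<open>quad_functions\<close>) count as
  quadratic functions, and for these the representation is faithful (\<open>quad_eval_inject\<close>).
  The vector space structure and topology are those of the ambient product type; since the space
  has finite dimension, the topology agrees with that of the inner product
  \<open>\<alpha>\<^sub>f \<alpha>\<^sub>g + 2 b\<^sub>f \<bullet> b\<^sub>g + tr (Q\<^sub>f Q\<^sub>g)\<close>.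
\<close>

type_synonym 'n quad = "real \<times> (real^'n) \<times> (real^'n^'n)"

definition qconst :: "'n::finite quad \<Rightarrow> real" where
  "qconst f = fst f"

definition qlin :: "'n::finite quad \<Rightarrow> real^'n" where
  "qlin f = fst (snd f)"

definition qmat :: "'n::finite quad \<Rightarrow> real^'n^'n" where
  "qmat f = snd (snd f)"

definition quad_functions :: "'n::finite quad set" where
  "quad_functions = {f. transpose (qmat f) = qmat f}"

definition quad_eval :: "'n::finite quad \<Rightarrow> real^'n \<Rightarrow> real" where
  "quad_eval f x = qconst f + 2 * (qlin f \<bullet> x) + x \<bullet> (qmat f *v x)"

definition quad_of_matrix :: "real^'n^'n \<Rightarrow> 'n::finite quad" where
  "quad_of_matrix M = (0, 0, M)"

text \<open>The coefficients of \<open>y \<mapsto> (1 + x \<bullet> y)\<^sup>2\<close>, see \<open>quad_eval_ev\<close>.\<close>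

definition ev :: "real^'n \<Rightarrow> 'n::finite quad" where
  "ev x = (1, x, (\<chi> i j. x $ i * x $ j))"

definition integer_vectors :: "(real^'n::finite) set" where
  "integer_vectors = {v. \<forall>i. v $ i \<in> \<int>}"

definition pos_definite :: "real^'n^'n::finite \<Rightarrow> bool" where
  "pos_definite A \<longleftrightarrow> transpose A = A \<and> (\<forall>x. x \<noteq> 0 \<longrightarrow> x \<bullet> (A *v x) > 0)"

definition erdahl_pos :: "'n::finite quad set" where
  "erdahl_pos = {f \<in> quad_functions. (\<forall>v\<in>integer_vectors. quad_eval f v \<ge> 0) \<and> pos_definite (qmat f)}"

text \<open>Here \<open>LEAST\<close> is the minimum over all of \<open>\<real>\<^sup>n\<close>, which is attained when \<open>qmat f\<close> is positive definite.\<close>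

definition qmu :: "'n::finite quad \<Rightarrow> real" where
  "qmu f = - (LEAST m. m \<in> range (quad_eval f))"

definition qcenter :: "'n::finite quad \<Rightarrow> real^'n" where
  "qcenter f = - (matrix_inv (qmat f) *v qlin f)"

definition Del :: "'n::finite quad \<Rightarrow> (real^'n) set" where
  "Del f = convex hull {v \<in> integer_vectors. quad_eval f v = 0}"

definition vert :: "(real^'n::finite) set \<Rightarrow> (real^'n) set" where
  "vert P = {v. v extreme_point_of P}"

definition hermite :: "'n::finite quad \<Rightarrow> real" where
  "hermite f = qmu f / root CARD('n) (det (qmat f))"

definition extreme :: "'n::finite quad \<Rightarrow> bool" where
  "extreme f \<longleftrightarrow> f \<in> erdahl_pos \<and> (\<forall>\<^sub>F g in at f within erdahl_pos. hermite g \<le> hermite f)"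

definition perfect :: "'n::finite quad \<Rightarrow> bool" where
  "perfect f \<longleftrightarrow> dim (span (ev ` vert (Del f))) = ((CARD('n) + 2) choose 2) - 1"

text \<open>For \<open>f \<in> erdahl_pos\<close> the vertex set is finite (\<open>finite_vert_Del\<close>), so the sum is a genuine one.\<close>

definition eutactic :: "'n::finite quad \<Rightarrow> bool" where
  "eutactic f \<longleftrightarrow> (\<exists>\<alpha> :: real^'n \<Rightarrow> real. (\<forall>v\<in>vert (Del f). \<alpha> v > 0) \<and>
     (\<Sum>v\<in>vert (Del f). \<alpha> v *\<^sub>R ev v) =
       ev (qcenter f) + quad_of_matrix ((qmu f / real CARD('n)) *\<^sub>R matrix_inv (qmat f)))"

lemma quad_eval_ev: "quad_eval (ev x) y = (1 + x \<bullet> y)\<^sup>2"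
proof -
  have "(\<chi> i j. x $ i * x $ j) *v y = (x \<bullet> y) *\<^sub>R x"
    by (simp add: matrix_vector_mult_def inner_vec_def vec_eq_iff sum_distrib_left sum_distrib_right mult_ac)
  then show ?thesis
    by (simp add: quad_eval_def ev_def qconst_def qlin_def qmat_def power2_eq_square
        algebra_simps inner_commute)
qed

lemma ev_in_quad_functions: "ev x \<in> quad_functions"
  by (simp add: ev_def quad_functions_def qmat_def transpose_def vec_eq_iff mult.commute)

lemma inner_sym_matrix:
  fixes A :: "real^'n^'n::finite"
  assumes "transpose A = A"
  shows "x \<bullet> (A *v y) = y \<bullet> (A *v x)"
  by (metis assms dot_lmul_matrix inner_commute vector_transpose_matrix)

lemma quad_eval_inject:
  fixes f g :: "'n::finite quad"
  assumes "f \<in> quad_functions" "g \<in> quad_functions" "\<And>x. quad_eval f x = quad_eval g x"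
  shows "f = g"
proof -
  have e: "qconst f + 2 * (qlin f \<bullet> x) + x \<bullet> (qmat f *v x) =
           qconst g + 2 * (qlin g \<bullet> x) + x \<bullet> (qmat g *v x)" for x
    using assms(3)[of x] by (simp add: quad_eval_def)
  have m: "(M :: real^'n^'n) *v (- x) = - (M *v x)" for M x
    by (simp add: matrix_vector_mult_def vec_eq_iff sum_negf)
  have c: "qconst f = qconst g" using e[of 0] by simp
  have b: "qlin f \<bullet> x = qlin g \<bullet> x" for x
    using e[of x] e[of "- x"] c by (simp add: m)
  then have l: "qlin f = qlin g" by (metis vector_eq_rdot)
  have q: "x \<bullet> (qmat f *v x) = x \<bullet> (qmat g *v x)" for x
    using e[of x] c l by simp
  have "x \<bullet> (qmat f *v y) = x \<bullet> (qmat g *v y)" for x y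
    using q[of "x + y"] q[of x] q[of y] assms(1,2)
      inner_sym_matrix[of "qmat f" x y] inner_sym_matrix[of "qmat g" x y]
    by (simp add: quad_functions_def matrix_vector_right_distrib inner_add_left inner_add_right)
  then have "qmat f *v y = qmat g *v y" for y by (metis vector_eq_ldot)
  then have "qmat f = qmat g" by (simp add: matrix_eq)
  with c l show ?thesis by (simp add: qconst_def qlin_def qmat_def prod_eq_iff)
qed

lemma finite_bounded_integer_vectors:
  fixes S :: "(real^'n::finite) set"
  assumes "bounded S" shows "finite (S \<inter> integer_vectors)"
proof -
  obtain B where B: "\<And>x. x \<in> S \<Longrightarrow> norm x \<le> B"
    using assms by (auto simp: bounded_iff)
  let ?F = "{z :: real. z \<in> \<int> \<and> \<bar>z\<bar> \<le> B}"
  have "S \<inter> integer_vectors \<subseteq> vec_lambda ` (UNIV \<rightarrow>\<^sub>E ?F)"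
  proof
    fix x assume x: "x \<in> S \<inter> integer_vectors"
    have "x $ i \<in> ?F" for i
      using x B[of x] component_le_norm_cart[of x i] by (auto simp: integer_vectors_def)
    then show "x \<in> vec_lambda ` (UNIV \<rightarrow>\<^sub>E ?F)"
      by (intro image_eqI[of _ _ "vec_nth x"]) auto
  qed
  moreover have "finite (UNIV \<rightarrow>\<^sub>E ?F :: ('n \<Rightarrow> real) set)"
    by (intro finite_PiE) (auto intro: finite_abs_int_segment)
  ultimately show ?thesis by (meson finite_imageI finite_subset)
qed

lemma bounded_quad_zeros:
  fixes f :: "'n::finite quad"
  assumes "pos_definite (qmat f)"
  shows "bounded {x. quad_eval f x = 0}"
proof -
  let ?q = "\<lambda>x. x \<bullet> (qmat f *v x)"
  let ?S = "sphere (0 :: real^'n) 1"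
  have "continuous_on ?S ?q"
    by (intro continuous_intros)
  moreover have "axis undefined 1 \<in> ?S"
    by (simp add: norm_eq_1 inner_axis_axis)
  ultimately obtain u where u: "u \<in> ?S" "\<And>x. x \<in> ?S \<Longrightarrow> ?q u \<le> ?q x"
    using continuous_attains_inf[of ?S ?q] by (metis compact_sphere empty_iff)
  define c where "c = ?q u"
  have "u \<noteq> 0" using u(1) by auto
  then have c: "c > 0" using assms by (auto simp: pos_definite_def c_def)
  have lower: "c * (norm x)\<^sup>2 \<le> ?q x" for x
  proof (cases "x = 0")
    case False
    have "c \<le> ?q ((1 / norm x) *\<^sub>R x)"
      unfolding c_def using False by (intro u(2)) simp
    also have "\<dots> = ?q x / (norm x)\<^sup>2"
      by (simp add: matrix_vector_mult_scaleR power2_eq_square)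
    finally show ?thesis using False by (simp add: field_simps)
  qed simp
  have "norm x \<le> 1 + (\<bar>qconst f\<bar> + 2 * norm (qlin f)) / c" if "quad_eval f x = 0" for x
  proof (cases "norm x \<le> 1")
    case True
    then show ?thesis using c by (smt (verit) divide_nonneg_pos norm_ge_zero)
  next
    case False
    then have n1: "norm x \<ge> 1" by simp
    have "c * (norm x)\<^sup>2 \<le> \<bar>qconst f\<bar> + 2 * (norm (qlin f) * norm x)"
      using lower[of x] that Cauchy_Schwarz_ineq2[of "qlin f" x]
      by (simp add: quad_eval_def)
    also have "\<dots> \<le> (\<bar>qconst f\<bar> + 2 * norm (qlin f)) * norm x"
      using mult_left_mono[OF n1, of "\<bar>qconst f\<bar>"] by (simp add: algebra_simps)
    finally have "(c * norm x) * norm x \<le> (\<bar>qconst f\<bar> + 2 * norm (qlin f)) * norm x"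
      by (simp only: power2_eq_square mult.assoc)
    moreover have "0 < norm x" using n1 by linarith
    ultimately have "c * norm x \<le> \<bar>qconst f\<bar> + 2 * norm (qlin f)"
      by (rule mult_right_le_imp_le)
    then have "norm x \<le> (\<bar>qconst f\<bar> + 2 * norm (qlin f)) / c"
      using c by (simp add: field_simps)
    then show ?thesis by simp
  qed
  then show ?thesis unfolding bounded_iff by blast
qed

lemma finite_vert_Del:
  assumes "f \<in> erdahl_pos"
  shows "finite (vert (Del f))"
proof (rule finite_subset)
  show "vert (Del f) \<subseteq> {x. quad_eval f x = 0} \<inter> integer_vectors"
    using extreme_point_of_convex_hull by (fastforce simp: vert_def Del_def)
  show "finite ({x. quad_eval f x = 0} \<inter> integer_vectors)"
    using assms by (intro finite_bounded_integer_vectors bounded_quad_zeros)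
      (auto simp: erdahl_pos_def)
qed

end

theory Submission
  imports Defs
begin

text \<open>
  Let \<open>\<kappa>\<close> be the Hermite invariant of \<open>f\<close> and \<open>D(Q)\<close> the \<open>n\<close>-th root of \<open>det Q\<close>. The function
  \<open>F(g) = \<mu>(g) - \<kappa> D(Q\<^sub>g)\<close> is convex on positive definite \<open>g\<close>, and \<open>F(g) \<le> 0\<close> iff the Hermite invariant
  of \<open>g\<close> is at most \<open>\<kappa>\<close>. Minus its gradient at \<open>g\<close> is \<open>w\<^sub>g = ev\<^sub>c + (\<kappa> D(Q\<^sub>g) / n) Q\<^sub>g\<^sup>-\<^sup>1\<close>, where \<open>c\<close> is the
  center of \<open>g\<close>; by the AM-GM inequality for \<open>tr (A\<^sup>-\<^sup>1 B)\<close> the resulting tangent inequality at \<open>f\<close> is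
  strict except along multiples of \<open>f\<close>.

  Near \<open>f\<close> the cone is cut out by the finitely many inequalities \<open>g(v) \<ge> 0\<close> at the integer zeros
  \<open>v\<close> of \<open>f\<close>, which are exactly the vertices of \<open>Del f\<close>. If \<open>f\<close> is extreme, then for every \<open>h\<close> that
  is nonnegative at these zeros and satisfies \<open>(h, w\<^sub>f) \<le> 0\<close> the strictness forces \<open>h\<close> to be a multiple
  of \<open>f\<close>. Applied to functions vanishing at all zeros this is perfection, and applied to
  a separating hyperplane it is eutaxy. Conversely, if \<open>f\<close> is perfect and eutactic, then \<open>(h, w\<^sub>f)\<close> dominates
  the norm of \<open>h\<close> for such \<open>h\<close> orthogonal to \<open>f\<close>, hence \<open>(g, w\<^sub>g) \<ge> 0\<close> near \<open>f\<close> by continuity of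
  \<open>w\<close>, and \<open>F(g) = - (g, w\<^sub>g)\<close>.
\<close>

section \<open>Simultaneous diagonalization and the determinant\<close>

lemma pos_definite_sym: "pos_definite A \<Longrightarrow> transpose A = A"
  by (simp add: pos_definite_def)

lemma pos_definite_pos: "pos_definite A \<Longrightarrow> x \<noteq> 0 \<Longrightarrow> x \<bullet> (A *v x) > 0"
  by (simp add: pos_definite_def)

lemma pos_definite_inner_commute:
  "pos_definite A \<Longrightarrow> x \<bullet> (A *v y) = y \<bullet> (A *v x)"
  by (simp add: pos_definite_def inner_sym_matrix)

lemma pos_definite_lower_bound:
  fixes A :: "real^'n::finite^'n"
  assumes "pos_definite A"
  obtains c where "c > 0" "\<And>x. c * (norm x)\<^sup>2 \<le> x \<bullet> (A *v x)"
proof -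
  let ?q = "\<lambda>x. x \<bullet> (A *v x)"
  let ?S = "sphere (0 :: real^'n) 1"
  have "continuous_on ?S ?q"
    by (intro continuous_intros)
  \<comment> \<open>A concrete unit vector, showing that the sphere is nonempty.\<close>
  moreover have "axis undefined 1 \<in> ?S"
    by (simp add: norm_eq_1 inner_axis_axis)
  ultimately obtain u where u: "u \<in> ?S" "\<And>x. x \<in> ?S \<Longrightarrow> ?q u \<le> ?q x"
    using continuous_attains_inf[of ?S ?q] by (metis compact_sphere empty_iff)
  have "u \<noteq> 0" using u(1) by auto
  then have "?q u > 0" using assms by (rule pos_definite_pos[rotated])
  moreover have "?q u * (norm x)\<^sup>2 \<le> ?q x" for x
  proof (cases "x = 0")
    case False
    have "?q u \<le> ?q ((1 / norm x) *\<^sub>R x)"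
      using False by (intro u(2)) simp
    also have "\<dots> = ?q x / (norm x)\<^sup>2"
      by (simp add: matrix_vector_mult_scaleR power2_eq_square)
    finally show ?thesis using False by (simp add: field_simps)
  qed simp
  ultimately show thesis by (rule that)
qed

text \<open>Near zero a linear term outweighs a quadratic one, and \<open>t\<close> may have either
  sign. This is the first-order condition at a maximizer.\<close>

lemma linear_coeff_zero:
  fixes b c :: real
  assumes "\<And>t. b * t \<le> c * t\<^sup>2"
  shows "b = 0"
proof (rule ccontr)
  assume "b \<noteq> 0"
  \<comment> \<open>Chosen so that \<open>b * t\<close> equals
    \<open>2 * (\<bar>c\<bar> + 1) * t\<^sup>2\<close>, which exceeds the quadratic bound.\<close>
  define t where "t = b / (2 * (\<bar>c\<bar> + 1))"
  have "b * t \<le> \<bar>c\<bar> * t\<^sup>2"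
    using assms[of t] by (meson abs_ge_self mult_right_mono order_trans zero_le_power2)
  moreover have "b = 2 * (\<bar>c\<bar> + 1) * t" by (simp add: t_def)
  then have "b * t = 2 * (\<bar>c\<bar> + 1) * t\<^sup>2"
    by (metis mult.assoc power2_eq_square)
  moreover have "t\<^sup>2 > 0" using \<open>b \<noteq> 0\<close> by (simp add: t_def)
  ultimately have "(\<bar>c\<bar> + 2) * t\<^sup>2 \<le> 0" by (simp add: algebra_simps)
  with \<open>t\<^sup>2 > 0\<close> show False
    by (smt (verit) mult_pos_pos abs_ge_zero)
qed

text \<open>Generalized eigenvectors are chosen one at a time, \<open>F\<close> indexing those
  already found. The third conjunct is the induction invariant: each \<open>B *v p i\<close> lies in
  the span of the vectors \<open>A *v p j\<close>, so the next vector can be sought in the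
  \<open>A\<close>-orthogonal complement alone.\<close>

lemma simultaneous_diagonalization_partial:
  fixes A B :: "real^'n::finite^'n"
  assumes A: "pos_definite A" and B: "transpose B = B" and "finite F"
  shows "\<exists>p::'n \<Rightarrow> real^'n. (\<forall>i\<in>F. p i \<bullet> (A *v p i) = 1) \<and>
      (\<forall>i\<in>F. \<forall>j\<in>F. i \<noteq> j \<longrightarrow> p i \<bullet> (A *v p j) = 0 \<and> p i \<bullet> (B *v p j) = 0) \<and>
      (\<forall>y. (\<forall>i\<in>F. y \<bullet> (A *v p i) = 0) \<longrightarrow> (\<forall>i\<in>F. y \<bullet> (B *v p i) = 0))"
  using \<open>finite F\<close>
proof (induction F rule: finite_induct)
  case (insert k F)
  then obtain p :: "'n \<Rightarrow> real^'n" where "(\<forall>i\<in>F. p i \<bullet> (A *v p i) = 1) \<and>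
      (\<forall>i\<in>F. \<forall>j\<in>F. i \<noteq> j \<longrightarrow> p i \<bullet> (A *v p j) = 0 \<and> p i \<bullet> (B *v p j) = 0) \<and>
      (\<forall>y. (\<forall>i\<in>F. y \<bullet> (A *v p i) = 0) \<longrightarrow> (\<forall>i\<in>F. y \<bullet> (B *v p i) = 0))"
    by (elim exE)
  then have p: "\<forall>i\<in>F. p i \<bullet> (A *v p i) = 1"
      "\<forall>i\<in>F. \<forall>j\<in>F. i \<noteq> j \<longrightarrow> p i \<bullet> (A *v p j) = 0 \<and> p i \<bullet> (B *v p j) = 0"
    and py: "\<And>y i. (\<And>j. j \<in> F \<Longrightarrow> y \<bullet> (A *v p j) = 0) \<Longrightarrow> i \<in> F \<Longrightarrow> y \<bullet> (B *v p i) = 0"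
    by simp_all
  note symA = inner_sym_matrix[OF pos_definite_sym[OF A]]
  note symB = inner_sym_matrix[OF B]
  define V where "V = {y. \<forall>i\<in>F. y \<bullet> (A *v p i) = 0}"
  have V_add: "x + y \<in> V" and V_scale: "a *\<^sub>R x \<in> V" if "x \<in> V" "y \<in> V" for x y a
    using that by (auto simp: V_def inner_add_left)
  \<comment> \<open>Since \<open>k\<close> is not in \<open>F\<close>, fewer than n linear
    conditions cut out \<open>V\<close>, so \<open>V\<close> contains a nonzero vector and the
    maximization below has a nonempty domain.\<close>
  have "dim ((\<lambda>i. A *v p i) ` F) \<le> card F"
    by (meson card_image_le dim_le_card' finite_imageI insert.hyps(1) le_trans)
  also have "card F < DIM(real^'n)"
    using insert.hyps by (metis DIM_cart DIM_real UNIV_I finite mult.right_neutral psubsetI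
        psubset_card_mono subset_UNIV)
  finally obtain v where v: "v \<noteq> 0" "\<And>y. y \<in> span ((\<lambda>i. A *v p i) ` F) \<Longrightarrow> orthogonal v y"
    using orthogonal_to_subspace_exists by metis
  then have vV: "v \<in> V"
    by (auto simp: V_def orthogonal_def span_base)
  let ?qA = "\<lambda>x. x \<bullet> (A *v x)" and ?qB = "\<lambda>x. x \<bullet> (B *v x)"
  let ?S = "sphere 0 1 \<inter> V"
  have "closed V"
  proof -
    have "V = (\<Inter>i\<in>F. {y. y \<bullet> (A *v p i) = 0})" by (auto simp: V_def)
    then show ?thesis
      by (auto intro!: closed_INT closed_Collect_eq continuous_intros)
  qed
  then have "compact ?S" by (simp add: compact_Int_closed)
  moreover have "v /\<^sub>R norm v \<in> ?S" using v(1) V_scale[OF vV vV] by simp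
  moreover have "continuous_on ?S (\<lambda>x. ?qB x / ?qA x)"
  proof (intro continuous_intros ballI)
    fix x :: "real^'n" assume "x \<in> ?S"
    then have "x \<noteq> 0" by auto
    from pos_definite_pos[OF A this] show "?qA x \<noteq> 0" by simp
  qed
  ultimately obtain u where u: "u \<in> ?S" "\<And>x. x \<in> ?S \<Longrightarrow> ?qB x / ?qA x \<le> ?qB u / ?qA u"
    using continuous_attains_sup[of ?S "\<lambda>x. ?qB x / ?qA x"] by blast
  \<comment> \<open>The largest generalized Rayleigh quotient on \<open>V\<close>; its maximizer is
    the next eigenvector.\<close>
  define m where "m = ?qB u / ?qA u"
  have u0: "u \<noteq> 0" "u \<in> V" using u(1) by auto
  have m: "?qB x \<le> m * ?qA x" if "x \<in> V" for x
  proof (cases "x = 0")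
    case False
    have "?qB (x /\<^sub>R norm x) / ?qA (x /\<^sub>R norm x) \<le> m"
      unfolding m_def using False V_scale[OF that that] by (intro u(2)) simp
    then have "?qB x / ?qA x \<le> m"
      using False by (simp add: matrix_vector_mult_scaleR)
    then show ?thesis using pos_definite_pos[OF A False] by (simp add: field_simps)
  qed simp
  \<comment> \<open>The quotient is invariant under scaling, so normalizing with respect to
    \<open>A\<close> keeps the value \<open>m\<close>.\<close>
  define w where "w = u /\<^sub>R sqrt (?qA u)"
  have wV: "w \<in> V" using V_scale u0 by (simp add: w_def)
  have wA: "?qA w = 1"
    using pos_definite_pos[OF A u0(1)] by (simp add: w_def matrix_vector_mult_scaleR field_simps)
  have wB: "?qB w = m"
    using pos_definite_pos[OF A u0(1)] by (simp add: w_def matrix_vector_mult_scaleR field_simps m_def)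
  \<comment> \<open>First-order optimality of \<open>w\<close>: the quotient of the two forms is stationary along \<open>w + t y\<close>.\<close>
  have key: "y \<bullet> (B *v w) = 0" if "y \<in> V" "y \<bullet> (A *v w) = 0" for y
  proof -
    have "(2 * (y \<bullet> (B *v w))) * t \<le> (m * ?qA y - ?qB y) * t\<^sup>2" for t
    proof -
      have "?qB (w + t *\<^sub>R y) \<le> m * ?qA (w + t *\<^sub>R y)"
        by (intro m V_add V_scale) (use wV that in auto)
      then show ?thesis
        using that(2) wA wB symA[of w y] symB[of w y]
        by (simp add: matrix_vector_mult_scaleR matrix_vector_right_distrib inner_add_left
            inner_add_right algebra_simps power2_eq_square)
    qed
    from linear_coeff_zero[OF this] show ?thesis by simp
  qed
  let ?p = "p(k := w)"
  have wF: "w \<bullet> (A *v p i) = 0" "w \<bullet> (B *v p i) = 0" "p i \<bullet> (A *v w) = 0" "p i \<bullet> (B *v w) = 0"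
    if "i \<in> F" for i
    using that wV py[of w i] symA[of w "p i"] symB[of w "p i"] by (auto simp: V_def)
  show ?case
  proof (intro exI[of _ ?p] conjI ballI allI impI)
    fix i assume "i \<in> insert k F"
    then show "?p i \<bullet> (A *v ?p i) = 1" using p wA insert.hyps by auto
  next
    fix i j assume "i \<in> insert k F" "j \<in> insert k F" "i \<noteq> j"
    then show "?p i \<bullet> (A *v ?p j) = 0" "?p i \<bullet> (B *v ?p j) = 0"
      using p wF by auto
  next
    \<comment> \<open>The invariant is restored: an old index uses the old invariant, the index
      \<open>k\<close> uses \<open>key\<close>.\<close>
    fix y i assume y: "\<forall>i\<in>insert k F. y \<bullet> (A *v ?p i) = 0" and i: "i \<in> insert k F"
    have "y \<bullet> (A *v p j) = 0" if "j \<in> F" for j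
      using y that insert.hyps by (metis fun_upd_other insertI2)
    moreover have "y \<bullet> (A *v w) = 0" using y by simp
    ultimately show "y \<bullet> (B *v ?p i) = 0"
      using i py key by (cases "i = k") (auto simp: V_def)
  qed
qed simp

lemma matrix_congruence_entry:
  fixes A P :: "real^'n::finite^'n"
  shows "(transpose P ** A ** P) $ i $ j = column i P \<bullet> (A *v column j P)"
  by (simp add: matrix_matrix_mult_def transpose_def column_def matrix_vector_mult_def inner_vec_def
      sum_distrib_left sum_distrib_right mult_ac)
    (subst sum.swap, simp add: mult_ac)

lemma simultaneous_diagonalization:
  fixes A B :: "real^'n::finite^'n"
  assumes "pos_definite A" "transpose B = B"
  obtains P :: "real^'n^'n" where "transpose P ** A ** P = mat 1"
    "\<And>i j. i \<noteq> j \<Longrightarrow> (transpose P ** B ** P) $ i $ j = 0"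
proof -
  obtain p :: "'n \<Rightarrow> real^'n" where p: "\<And>i. p i \<bullet> (A *v p i) = 1"
    "\<And>i j. i \<noteq> j \<Longrightarrow> p i \<bullet> (A *v p j) = 0 \<and> p i \<bullet> (B *v p j) = 0"
    using simultaneous_diagonalization_partial[OF assms finite[of UNIV]] by auto
  define P :: "real^'n^'n" where "P = (\<chi> i j. p j $ i)"
  have col: "column j P = p j" for j by (simp add: P_def column_def)
  show thesis
  proof (rule that)
    show "transpose P ** A ** P = mat 1"
      using p by (simp add: vec_eq_iff matrix_congruence_entry col mat_def)
  qed (use p in \<open>simp add: matrix_congruence_entry col\<close>)
qed

text \<open>Congruence of \<open>A\<close> to the identity makes \<open>det A\<close> times the
  square of \<open>det P\<close> equal to 1.\<close>

lemma pos_definite_det_pos: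
  fixes A :: "real^'n::finite^'n"
  assumes "pos_definite A"
  shows "det A > 0"
proof -
  obtain P :: "real^'n^'n" where "transpose P ** A ** P = mat 1"
    using simultaneous_diagonalization assms pos_definite_sym by blast
  then have "det P * det A * det P = 1" by (metis det_I det_mul det_transpose)
  then have "det A * (det P)\<^sup>2 = 1" by (simp add: power2_eq_square mult_ac)
  then show ?thesis
    by (smt (verit) mult_nonpos_nonneg zero_le_power2)
qed

lemma matrix_inv_cancel:
  fixes A :: "real^'n::finite^'n"
  assumes "det A \<noteq> 0"
  shows "A ** matrix_inv A = mat 1" "matrix_inv A ** A = mat 1"
  using someI_ex[of "\<lambda>A'. A ** A' = mat 1 \<and> A' ** A = mat 1"] assms
  by (auto simp: matrix_inv_def invertible_det_nz[symmetric] invertible_def)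

lemma matrix_inv_eqI:
  fixes A B :: "real^'n::finite^'n"
  assumes "B ** A = mat 1"
  shows "matrix_inv A = B"
proof -
  have "det A \<noteq> 0" using assms by (metis det_I det_mul mult_zero_right zero_neq_one)
  then have "B ** (A ** matrix_inv A) = B" by (simp add: matrix_inv_cancel)
  then show ?thesis using assms by (simp add: matrix_mul_assoc)
qed

section \<open>AM-GM for traces and determinants\<close>

lemma sum_ln_le_mean:
  fixes d :: "'a \<Rightarrow> real"
  assumes "finite S" "S \<noteq> {}" and d: "\<And>i. i \<in> S \<Longrightarrow> d i > 0"
  shows "(\<Sum>i\<in>S. ln (d i)) \<le> card S * ln (sum d S / card S)"
    and "(\<Sum>i\<in>S. ln (d i)) = card S * ln (sum d S / card S) \<Longrightarrow> i \<in> S \<Longrightarrow> d i = sum d S / card S"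
proof -
  define a where "a = sum d S / card S"
  have c: "card S > 0" using assms by (simp add: card_gt_0_iff)
  have a: "a > 0" unfolding a_def using c assms by (intro divide_pos_pos sum_pos) auto
  \<comment> \<open>The defect in ln x <= x - 1 at x = \<open>d i / a\<close>; it vanishes only at x
    = 1.\<close>
  have le: "0 \<le> d i / a - 1 - ln (d i / a)" if "i \<in> S" for i
    using ln_le_minus_one[of "d i / a"] d[OF that] a by simp
  \<comment> \<open>The linear terms cancel because \<open>a\<close> is the mean, so the defects add
    up to exactly the gap in the inequality. The equality case follows as well.\<close>
  have sum: "(\<Sum>i\<in>S. d i / a - 1 - ln (d i / a)) = card S * ln a - (\<Sum>i\<in>S. ln (d i))"
  proof -
    have "(\<Sum>i\<in>S. d i / a - 1 - ln (d i / a)) = (\<Sum>i\<in>S. d i / a - 1 - (ln (d i) - ln a))"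
      using d[THEN less_imp_neq] a by (intro sum.cong refl) (simp add: ln_div)
    also have "\<dots> = sum d S / a - card S - (\<Sum>i\<in>S. ln (d i)) + card S * ln a"
      by (simp add: sum_subtractf sum_divide_distrib)
    also have "sum d S = card S * a" using c by (simp add: a_def)
    also have "card S * a / a = card S" using a by simp
    finally show ?thesis by simp
  qed
  show "(\<Sum>i\<in>S. ln (d i)) \<le> card S * ln (sum d S / card S)"
  proof -
    have "0 \<le> (\<Sum>i\<in>S. d i / a - 1 - ln (d i / a))" by (intro sum_nonneg le)
    then show ?thesis unfolding a_def[symmetric] sum by simp
  qed
  assume "(\<Sum>i\<in>S. ln (d i)) = card S * ln (sum d S / card S)" "i \<in> S"
  then have "d i / a - 1 - ln (d i / a) = 0"
    using sum_nonneg_eq_0_iff[OF assms(1), of "\<lambda>i. d i / a - 1 - ln (d i / a)"] le sum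
    by (simp add: a_def[symmetric])
  then have "d i / a = 1"
    using d[OF \<open>i \<in> S\<close>] a by (intro ln_eq_minus_one) auto
  then show "d i = sum d S / card S" using a by (simp add: a_def[symmetric])
qed

definition root_det :: "real^'n::finite^'n \<Rightarrow> real" where
  "root_det A = root CARD('n) (det A)"

lemma root_det_pos: "pos_definite A \<Longrightarrow> root_det A > 0"
  by (simp add: root_det_def pos_definite_det_pos)

lemma transpose_scaleR: "transpose (s *\<^sub>R A) = s *\<^sub>R transpose (A :: real^'n^'m)"
  by (simp add: transpose_def vec_eq_iff)

lemma ln_root_det:
  fixes A :: "real^'n::finite^'n"
  assumes "pos_definite A"
  shows "CARD('n) * ln (root_det A) = ln (det A)"
  using pos_definite_det_pos[OF assms] by (simp add: root_det_def ln_root)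

text \<open>The inner product on matrices is entrywise, so this is the cyclicity of the
  trace.\<close>

lemma inner_matrix_mult_transpose:
  fixes P B :: "real^'n::finite^'n"
  shows "(P ** transpose P) \<bullet> B = (\<Sum>k\<in>UNIV. (transpose P ** B ** P) $ k $ k)"
proof -
  have "(P ** transpose P) \<bullet> B = (\<Sum>i\<in>UNIV. \<Sum>j\<in>UNIV. \<Sum>k\<in>UNIV. P$i$k * P$j$k * B$i$j)"
    by (simp add: inner_vec_def matrix_matrix_mult_def transpose_def sum_distrib_right)
  also have "\<dots> = (\<Sum>i\<in>UNIV. \<Sum>k\<in>UNIV. \<Sum>j\<in>UNIV. P$i$k * P$j$k * B$i$j)"
    by (intro sum.cong refl sum.swap)
  also have "\<dots> = (\<Sum>k\<in>UNIV. \<Sum>i\<in>UNIV. \<Sum>j\<in>UNIV. P$i$k * P$j$k * B$i$j)"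
    by (rule sum.swap)
  also have "\<dots> = (\<Sum>k\<in>UNIV. (transpose P ** B ** P) $ k $ k)"
    by (simp add: matrix_congruence_entry inner_vec_def matrix_vector_mult_def column_def
        sum_distrib_left mult_ac)
  finally show ?thesis .
qed

text \<open>A congruence turns \<open>A\<close> into the identity and \<open>B\<close> into a
  diagonal matrix; trace and determinant ratio become sum and product of the diagonal entries, and
  AM-GM applies. The bound says that \<open>root_det\<close> lies below its tangent at
  \<open>A\<close>, touching it only along multiples of \<open>A\<close>.\<close>

lemma trace_AM_GM:
  fixes A B :: "real^'n::finite^'n"
  assumes A: "pos_definite A" and B: "pos_definite B"
  shows "matrix_inv A \<bullet> B \<ge> CARD('n) * (root_det B / root_det A)"
    and "matrix_inv A \<bullet> B = CARD('n) * (root_det B / root_det A) \<Longrightarrow> \<exists>s>0. B = s *\<^sub>R A"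
proof -
  obtain P :: "real^'n^'n" where PA: "transpose P ** A ** P = mat 1"
    and PB: "\<And>i j. i \<noteq> j \<Longrightarrow> (transpose P ** B ** P) $ i $ j = 0"
    using simultaneous_diagonalization[OF A pos_definite_sym[OF B]] by blast
  define D where "D = transpose P ** B ** P"
  define d where "d i = D $ i $ i" for i
  \<comment> \<open>\<open>P ** transpose P\<close> is the inverse of \<open>A\<close>, which makes
    the trace the sum of the \<open>d i\<close>.\<close>
  have inv: "P ** transpose P ** A = mat 1"
    using PA by (metis matrix_left_right_inverse matrix_mul_assoc)
  then have tr: "matrix_inv A \<bullet> B = sum d UNIV"
    by (simp add: matrix_inv_eqI inner_matrix_mult_transpose d_def D_def)
  have detP: "det P \<noteq> 0"
    using PA by (metis det_I det_mul mult_zero_right zero_neq_one)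
  have d_pos: "d i > 0" for i
  proof -
    have "column i P \<noteq> 0" using detP by (metis det_zero_column(1))
    then show ?thesis using B by (simp add: d_def D_def matrix_congruence_entry pos_definite_pos)
  qed
  have "det D = prod d UNIV"
    using PB by (simp add: det_diagonal D_def d_def)
  moreover have "det D * det A = det B"
  proof -
    have "det P * det A * det P = 1" using PA by (metis det_I det_mul det_transpose)
    then show ?thesis by (simp add: D_def det_mul) (metis mult.commute mult.left_commute mult_1)
  qed
  ultimately have "det B / det A = prod d UNIV"
    using pos_definite_det_pos[OF A] by (simp add: field_simps)
  then have "ln (det B) - ln (det A) = (\<Sum>i\<in>UNIV. ln (d i))"
    using pos_definite_det_pos[OF A] pos_definite_det_pos[OF B] ln_prod[of UNIV d] d_pos
      ln_div[of "det B" "det A"] by (simp add: less_imp_neq[symmetric])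
  then have ln: "(\<Sum>i\<in>UNIV. ln (d i)) = CARD('n) * ln (root_det B / root_det A)"
    using ln_root_det[OF A] ln_root_det[OF B] root_det_pos[OF A] root_det_pos[OF B]
    by (simp add: ln_div right_diff_distrib)
  have pos: "root_det B / root_det A > 0" "sum d UNIV > 0"
    using root_det_pos[OF A] root_det_pos[OF B] d_pos by (auto intro!: sum_pos)
  have "CARD('n) * ln (root_det B / root_det A) \<le> CARD('n) * ln (sum d UNIV / CARD('n))"
    using sum_ln_le_mean(1)[of UNIV d] d_pos ln by simp
  then have "root_det B / root_det A \<le> sum d UNIV / CARD('n)"
    using pos by simp
  then show "matrix_inv A \<bullet> B \<ge> CARD('n) * (root_det B / root_det A)"
    by (simp add: tr field_simps)
  assume "matrix_inv A \<bullet> B = CARD('n) * (root_det B / root_det A)"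
  then have mean: "sum d UNIV / CARD('n) = root_det B / root_det A"
    by (simp add: tr)
  define s where "s = root_det B / root_det A"
  have "d i = s" for i
    using sum_ln_le_mean(2)[of UNIV d i] d_pos mean ln by (simp add: s_def)
  then have "D = s *\<^sub>R mat 1"
    using PB by (simp add: vec_eq_iff mat_def D_def d_def)
  then have "transpose P ** B ** P = transpose P ** (s *\<^sub>R A) ** P"
    using PA by (simp add: D_def matrix_scalar_ac scalar_matrix_assoc[symmetric])
  \<comment> \<open>Multiplying by \<open>P\<close> on the left and \<open>transpose P ** A\<close>
    on the right leaves only products that are the identity, so \<open>P\<close> can be
    cancelled.\<close>
  then have "(P ** transpose P ** A) ** matrix_inv A ** B ** (P ** transpose P ** A) =
     (P ** transpose P ** A) ** matrix_inv A ** (s *\<^sub>R A) ** (P ** transpose P ** A)"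
    using inv by (metis matrix_inv_eqI matrix_mul_assoc matrix_mul_lid)
  then have "matrix_inv A ** B = matrix_inv A ** (s *\<^sub>R A)"
    by (simp add: inv)
  then have "A ** matrix_inv A ** B = A ** matrix_inv A ** (s *\<^sub>R A)"
    by (metis matrix_mul_assoc)
  then have "B = s *\<^sub>R A"
    using pos_definite_det_pos[OF A] by (simp add: matrix_inv_cancel)
  then show "\<exists>s>0. B = s *\<^sub>R A" using pos by (auto simp: s_def)
qed

section \<open>Quadratic functions in the Erdahl cone\<close>

lemma root_det_scaleR:
  fixes A :: "real^'n::finite^'n"
  assumes "s > 0"
  shows "root_det (s *\<^sub>R A) = s * root_det A"
proof -
  have "s *\<^sub>R A = (\<chi> i. s *s A $ i)"
    by (simp add: vec_eq_iff)
  then have "det (s *\<^sub>R A) = s ^ CARD('n) * det A"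
    by (simp add: det_rows_mul)
  then show ?thesis
    using assms by (simp add: root_det_def real_root_mult real_root_power_cancel)
qed

lemma matrix_inv_inner_self:
  fixes A :: "real^'n::finite^'n"
  assumes "pos_definite A"
  shows "matrix_inv A \<bullet> A = CARD('n)"
proof -
  have "matrix_inv A \<bullet> A = trace (matrix_inv A ** transpose A)"
    by (simp add: inner_vec_def trace_def matrix_matrix_mult_def transpose_def)
  also have "\<dots> = CARD('n)"
    using pos_definite_det_pos[OF assms] pos_definite_sym[OF assms]
    by (simp add: matrix_inv_cancel trace_I)
  finally show ?thesis .
qed

section \<open>Coefficients, center and minimum of a quadratic function\<close>

lemma qconst_simps [simp]:
  "qconst (f + g) = qconst f + qconst g" "qconst (f - g) = qconst f - qconst g"
  "qconst (t *\<^sub>R f) = t * qconst f" "qconst (0 :: 'n::finite quad) = 0"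
  by (simp_all add: qconst_def)

lemma qlin_simps [simp]:
  "qlin (f + g) = qlin f + qlin g" "qlin (f - g) = qlin f - qlin g"
  "qlin (t *\<^sub>R f) = t *\<^sub>R qlin f" "qlin (0 :: 'n::finite quad) = 0"
  by (simp_all add: qlin_def)

lemma qmat_simps [simp]:
  "qmat (f + g) = qmat f + qmat g" "qmat (f - g) = qmat f - qmat g"
  "qmat (t *\<^sub>R f) = t *\<^sub>R qmat f" "qmat (0 :: 'n::finite quad) = 0"
  by (simp_all add: qmat_def)

lemma quad_eqI: "qconst f = qconst g \<Longrightarrow> qlin f = qlin g \<Longrightarrow> qmat f = qmat g \<Longrightarrow> f = g"
  by (simp add: qconst_def qlin_def qmat_def prod_eq_iff)

lemma quad_eval_add [simp]: "quad_eval (f + g) x = quad_eval f x + quad_eval g x"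
  by (simp add: quad_eval_def inner_add_left inner_add_right matrix_vector_mult_add_rdistrib algebra_simps)

lemma quad_eval_scaleR [simp]: "quad_eval (t *\<^sub>R f) x = t * quad_eval f x"
  by (simp add: quad_eval_def algebra_simps scaleR_matrix_vector_assoc[symmetric])

lemma subspace_quad_functions: "subspace quad_functions"
  by (auto simp: subspace_def quad_functions_def transpose_def vec_eq_iff)

lemma erdahl_posD:
  assumes "f \<in> erdahl_pos"
  shows "f \<in> quad_functions" "pos_definite (qmat f)" "\<And>v. v \<in> integer_vectors \<Longrightarrow> quad_eval f v \<ge> 0"
  using assms by (auto simp: erdahl_pos_def)

lemma pos_definite_quad_functions: "pos_definite (qmat f) \<Longrightarrow> f \<in> quad_functions"
  by (simp add: quad_functions_def pos_definite_sym)

lemma qmat_qcenter: "pos_definite (qmat f) \<Longrightarrow> qmat f *v qcenter f = - qlin f"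
  using pos_definite_det_pos[of "qmat f"]
  by (simp add: qcenter_def matrix_vector_mul_assoc matrix_inv_cancel
      linear_neg[OF matrix_vector_mul_linear])

text \<open>Completing the square: the linear terms cancel by the equation that
  \<open>qmat_qcenter\<close> gives for the center.\<close>

lemma quad_eval_centered:
  assumes "pos_definite (qmat f)"
  shows "quad_eval f x = (x - qcenter f) \<bullet> (qmat f *v (x - qcenter f)) + quad_eval f (qcenter f)"
  using qmat_qcenter[OF assms] pos_definite_inner_commute[OF assms, of "qcenter f" x]
  by (simp add: quad_eval_def matrix_vector_mult_diff_distrib inner_diff_left inner_diff_right
      inner_add_right inner_commute)

lemma quad_eval_qcenter:
  assumes "pos_definite (qmat f)"
  shows "quad_eval f (qcenter f) = - qmu f"
proof -
  have "quad_eval f (qcenter f) \<le> quad_eval f x" for x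
    using pos_definite_pos[OF assms, of "x - qcenter f"] quad_eval_centered[OF assms, of x]
    by (cases "x = qcenter f") auto
  then have "(LEAST m. m \<in> range (quad_eval f)) = quad_eval f (qcenter f)"
    by (intro Least_equality) auto
  then show ?thesis by (simp add: qmu_def)
qed

lemma quad_eval_ge_qmu:
  assumes "pos_definite (qmat f)"
  shows "quad_eval f x \<ge> - qmu f"
    and "quad_eval f x = - qmu f \<Longrightarrow> x = qcenter f"
  using quad_eval_centered[OF assms, of x] quad_eval_qcenter[OF assms]
    pos_definite_pos[OF assms, of "x - qcenter f"] by (cases "x = qcenter f"; force)+

text \<open>The completed square involves only matrix, center and minimum, so these three determine
  the function. Equality in the tangent inequality will supply them.\<close>

lemma eq_scaleR_quadI:
  assumes f: "pos_definite (qmat f)" and g: "pos_definite (qmat g)"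
    and "qmat f = s *\<^sub>R qmat g" "qcenter f = qcenter g" "qmu f = s * qmu g"
  shows "f = s *\<^sub>R g"
proof (rule quad_eval_inject)
  show "f \<in> quad_functions" "s *\<^sub>R g \<in> quad_functions"
    using f g by (auto intro: pos_definite_quad_functions subspace_mul[OF subspace_quad_functions])
  show "quad_eval f x = quad_eval (s *\<^sub>R g) x" for x
  proof -
    have "quad_eval f x = (x - qcenter g) \<bullet> (s *\<^sub>R qmat g *v (x - qcenter g)) - s * qmu g"
      using quad_eval_centered[OF f, of x] quad_eval_qcenter[OF f] assms(3-) by simp
    moreover have "quad_eval g x = (x - qcenter g) \<bullet> (qmat g *v (x - qcenter g)) - qmu g"
      using quad_eval_centered[OF g, of x] quad_eval_qcenter[OF g] by simp
    ultimately show ?thesis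
      by (simp add: scaleR_matrix_vector_assoc[symmetric] right_diff_distrib)
  qed
qed

text \<open>The dual coordinates turn the paper's inner product, in which the linear part has weight 2,
  into the inner product of the product type.\<close>

definition qdual :: "'n::finite quad \<Rightarrow> 'n quad" where
  "qdual h = (qconst h, 2 *\<^sub>R qlin h, qmat h)"

lemma linear_qdual: "linear (qdual :: 'n::finite quad \<Rightarrow> 'n quad)"
  by (rule linearI) (simp_all add: qdual_def algebra_simps)

lemma qdual_inject: "qdual h = qdual k \<longleftrightarrow> h = k"
  by (auto simp: qdual_def intro: quad_eqI)

lemma inner_qdual: "k \<bullet> qdual h = qconst k * qconst h + 2 * (qlin k \<bullet> qlin h) + qmat k \<bullet> qmat h"
  by (cases k) (simp add: qdual_def qconst_def qlin_def qmat_def)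

section \<open>Evaluation as an inner product, and the tangent inequality\<close>

lemma outer_product_inner:
  fixes M :: "real^'n::finite^'n"
  shows "(\<chi> i j. x $ i * x $ j) \<bullet> M = x \<bullet> (M *v x)"
  by (simp add: inner_vec_def matrix_vector_mult_def sum_distrib_left mult_ac)

lemma ev_inner_qdual: "ev x \<bullet> qdual h = quad_eval h x"
  unfolding inner_qdual quad_eval_def inner_commute[of "qlin h" x]
  by (simp add: ev_def qconst_def qlin_def qmat_def outer_product_inner)

text \<open>\<open>\<kappa>\<close> is a separate parameter because it stays fixed while
  \<open>g\<close> moves. For \<open>g = f\<close> and \<open>\<kappa> = hermite f\<close> the
  matrix coefficient is \<open>qmu f / n\<close>, which gives the right-hand side of the eutaxy
  equation.\<close>

definition hermite_normal :: "real \<Rightarrow> 'n::finite quad \<Rightarrow> 'n quad" where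
  "hermite_normal \<kappa> g =
    ev (qcenter g) + quad_of_matrix ((\<kappa> * root_det (qmat g) / CARD('n)) *\<^sub>R matrix_inv (qmat g))"

lemma hermite_normal_inner:
  fixes g h :: "'n::finite quad"
  shows "hermite_normal \<kappa> g \<bullet> qdual h =
    quad_eval h (qcenter g) + \<kappa> * root_det (qmat g) / CARD('n) * (matrix_inv (qmat g) \<bullet> qmat h)"
  by (simp add: hermite_normal_def inner_add_left ev_inner_qdual)
    (simp add: inner_qdual quad_of_matrix_def qconst_def qlin_def qmat_def)

text \<open>Euler's relation for a function homogeneous of degree one: pairing the gradient with the
  point returns the value.\<close>

lemma hermite_normal_inner_self:
  fixes g :: "'n::finite quad"
  assumes "pos_definite (qmat g)"
  shows "hermite_normal \<kappa> g \<bullet> qdual g = \<kappa> * root_det (qmat g) - qmu g"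
  using assms by (simp add: hermite_normal_inner matrix_inv_inner_self quad_eval_qcenter)

text \<open>The function \<open>f \<mapsto> qmu f - \<kappa> * root_det (qmat f)\<close> is convex for \<open>\<kappa> \<ge> 0\<close>, and
  \<open>- hermite_normal \<kappa> g\<close> is a subgradient at \<open>g\<close>.\<close>

lemma hermite_normal_inner_ge:
  fixes f g :: "'n::finite quad"
  assumes f: "pos_definite (qmat f)" and g: "pos_definite (qmat g)" and "\<kappa> \<ge> 0"
  shows "hermite_normal \<kappa> g \<bullet> qdual f \<ge> \<kappa> * root_det (qmat f) - qmu f"
    and "\<kappa> > 0 \<Longrightarrow> hermite_normal \<kappa> g \<bullet> qdual f = \<kappa> * root_det (qmat f) - qmu f \<Longrightarrow>
      qcenter g = qcenter f \<and> (\<exists>s>0. qmat f = s *\<^sub>R qmat g)"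
proof -
  define T where "T = matrix_inv (qmat g) \<bullet> qmat f"
  define r where "r = root_det (qmat f) / root_det (qmat g)"
  have rg: "root_det (qmat g) > 0" by (rule root_det_pos[OF g])
  have T: "T \<ge> CARD('n) * r" unfolding T_def r_def by (rule trace_AM_GM[OF g f])
  \<comment> \<open>The gap splits into two nonnegative parts: the excess of \<open>f\<close> over
    its minimum at the center of \<open>g\<close>, and the gap in AM-GM.\<close>
  have eq: "hermite_normal \<kappa> g \<bullet> qdual f - (\<kappa> * root_det (qmat f) - qmu f) =
      (quad_eval f (qcenter g) + qmu f) + \<kappa> * root_det (qmat g) / CARD('n) * (T - CARD('n) * r)"
    using rg by (simp add: hermite_normal_inner T_def r_def field_simps)
  have a: "quad_eval f (qcenter g) + qmu f \<ge> 0"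
    using quad_eval_ge_qmu(1)[OF f, of "qcenter g"] by simp
  have b: "\<kappa> * root_det (qmat g) / CARD('n) * (T - CARD('n) * r) \<ge> 0"
    using T rg \<open>\<kappa> \<ge> 0\<close> by simp
  show "hermite_normal \<kappa> g \<bullet> qdual f \<ge> \<kappa> * root_det (qmat f) - qmu f"
    using eq a b by linarith
  assume "\<kappa> > 0" "hermite_normal \<kappa> g \<bullet> qdual f = \<kappa> * root_det (qmat f) - qmu f"
  \<comment> \<open>Equality kills both parts: uniqueness of the minimizer identifies the centers,
    the equality case of AM-GM the matrices up to scale.\<close>
  then have "quad_eval f (qcenter g) = - qmu f"
    and "\<kappa> * root_det (qmat g) / CARD('n) * (T - CARD('n) * r) = 0"
    using eq a b by linarith+
  then show "qcenter g = qcenter f \<and> (\<exists>s>0. qmat f = s *\<^sub>R qmat g)"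
    using quad_eval_ge_qmu(2)[OF f] trace_AM_GM(2)[OF g f] rg \<open>\<kappa> > 0\<close>
    by (auto simp: T_def r_def)
qed

lemma hermite_root_det: "hermite f = qmu f / root_det (qmat f)"
  by (simp add: hermite_def root_det_def)

lemma hermite_le_iff:
  assumes "pos_definite (qmat g)"
  shows "hermite g \<le> \<kappa> \<longleftrightarrow> qmu g \<le> \<kappa> * root_det (qmat g)"
  using root_det_pos[OF assms] by (simp add: hermite_root_det field_simps)

lemma qmu_eq_hermite:
  assumes "pos_definite (qmat f)"
  shows "qmu f = hermite f * root_det (qmat f)"
  using root_det_pos[OF assms] by (simp add: hermite_root_det)

section \<open>Perturbations that stay in the cone\<close>

lemma quad_eval_growth:
  fixes h :: "'n::finite quad"
  obtains M where "M > 0" "\<And>x. \<bar>quad_eval h x\<bar> \<le> M * (1 + (norm x)\<^sup>2)"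
    "\<And>x. \<bar>x \<bullet> (qmat h *v x)\<bar> \<le> M * (norm x)\<^sup>2"
proof -
  obtain K where K: "K > 0" "\<And>x. norm (qmat h *v x) \<le> K * norm x"
    using linear_bounded_pos[OF matrix_vector_mul_linear[of "qmat h"]] by auto
  define M where "M = K + \<bar>qconst h\<bar> + norm (qlin h)"
  have q: "\<bar>x \<bullet> (qmat h *v x)\<bar> \<le> K * (norm x)\<^sup>2" for x
  proof -
    have "\<bar>x \<bullet> (qmat h *v x)\<bar> \<le> norm x * norm (qmat h *v x)" by (rule Cauchy_Schwarz_ineq2)
    also have "\<dots> \<le> norm x * (K * norm x)" using K(2) by (intro mult_left_mono) auto
    finally show ?thesis by (simp add: power2_eq_square mult_ac)
  qed
  have l: "\<bar>2 * (qlin h \<bullet> x)\<bar> \<le> norm (qlin h) * (1 + (norm x)\<^sup>2)" for x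
  proof -
    have "\<bar>2 * (qlin h \<bullet> x)\<bar> \<le> norm (qlin h) * (2 * norm x)"
      using Cauchy_Schwarz_ineq2[of "qlin h" x] by simp
    also have "2 * norm x \<le> 1 + (norm x)\<^sup>2"
      using zero_le_power2[of "norm x - 1"] by (simp add: power2_eq_square algebra_simps)
    finally show ?thesis by (simp add: mult_left_mono)
  qed
  show thesis
  proof (rule that)
    show "M > 0" using K by (simp add: M_def add_pos_nonneg)
    show "\<bar>x \<bullet> (qmat h *v x)\<bar> \<le> M * (norm x)\<^sup>2" for x
      using q[of x] by (rule order_trans) (simp add: M_def mult_right_mono)
    show "\<bar>quad_eval h x\<bar> \<le> M * (1 + (norm x)\<^sup>2)" for x
    proof -
      have "\<bar>quad_eval h x\<bar> \<le> \<bar>qconst h\<bar> + norm (qlin h) * (1 + (norm x)\<^sup>2) + K * (norm x)\<^sup>2"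
        using q[of x] l[of x] by (simp add: quad_eval_def)
      also have "\<dots> \<le> M * (1 + (norm x)\<^sup>2)"
        using K by (simp add: M_def algebra_simps)
      finally show ?thesis .
    qed
  qed
qed

text \<open>A positive definite form grows like c |x|^2, so \<open>f\<close> can be below a quarter
  of that rate only on a bounded set. The same \<epsilon> controls integer values and positive
  definiteness.\<close>

lemma finite_integer_small_values:
  fixes f :: "'n::finite quad"
  assumes f: "pos_definite (qmat f)"
  obtains \<epsilon> where "\<epsilon> > 0" "finite {v \<in> integer_vectors. quad_eval f v < \<epsilon> * (1 + (norm v)\<^sup>2)}"
    "\<And>x. \<epsilon> * (norm x)\<^sup>2 \<le> x \<bullet> (qmat f *v x)"
proof -
  obtain c where c: "c > 0" "\<And>x. c * (norm x)\<^sup>2 \<le> x \<bullet> (qmat f *v x)"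
    using pos_definite_lower_bound[OF f] by blast
  define z where "z = qcenter f"
  \<comment> \<open>Obtained from c |x - z|^2 <= f(x) + \<mu> and |x|^2 <= 2 |x - z|^2 + 2 |z|^2,
    after half of the left side has absorbed the |x - z|^2 term.\<close>
  define R where "R = (qmu f + c / 4 * (1 + 2 * (norm z)\<^sup>2)) / (c / 2)"
  have "norm (x - z) \<le> sqrt R" if "quad_eval f x < c / 4 * (1 + (norm x)\<^sup>2)" for x
  proof -
    have "(norm x)\<^sup>2 \<le> 2 * (norm (x - z))\<^sup>2 + 2 * (norm z)\<^sup>2"
      using zero_le_power2[of "norm (x - 2 *\<^sub>R z)"]
      unfolding power2_norm_eq_inner by (simp add: inner_diff inner_commute algebra_simps)
    then have "c / 4 * (1 + (norm x)\<^sup>2) \<le> c / 4 * (1 + (2 * (norm (x - z))\<^sup>2 + 2 * (norm z)\<^sup>2))"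
      using c(1) by simp
    moreover have "c * (norm (x - z))\<^sup>2 \<le> quad_eval f x + qmu f"
      using c(2)[of "x - z"] quad_eval_centered[OF f, of x] quad_eval_qcenter[OF f]
      by (simp add: z_def)
    ultimately have "c / 2 * (norm (x - z))\<^sup>2 \<le> qmu f + c / 4 * (1 + 2 * (norm z)\<^sup>2)"
      using that by (simp add: algebra_simps)
    then have "(norm (x - z))\<^sup>2 \<le> R" using c(1) by (simp add: R_def field_simps)
    then show ?thesis by (rule real_le_rsqrt)
  qed
  then have "{x. quad_eval f x < c / 4 * (1 + (norm x)\<^sup>2)} \<subseteq> cball z (sqrt R)"
    by (auto simp: dist_norm norm_minus_commute)
  then have "bounded {x. quad_eval f x < c / 4 * (1 + (norm x)\<^sup>2)}"
    using bounded_cball bounded_subset by blast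
  from finite_bounded_integer_vectors[OF this]
  have "finite {v \<in> integer_vectors. quad_eval f v < c / 4 * (1 + (norm v)\<^sup>2)}"
    by (rule rev_finite_subset) auto
  moreover have "c / 4 * (norm x)\<^sup>2 \<le> x \<bullet> (qmat f *v x)" for x
    using c(1) by (intro order_trans[OF _ c(2)] mult_right_mono) auto
  ultimately show thesis using c(1) by (intro that[of "c / 4"]) auto
qed

text \<open>Outside a finite set of integer points \<open>f\<close> dominates \<open>t * h\<close>
  uniformly, both growing at most quadratically in comparable terms. Inside it, a zero of
  \<open>f\<close> is covered by \<open>nonneg\<close> and a positive value survives small
  \<open>t\<close>.\<close>

lemma eventually_erdahl_pos:
  fixes f h :: "'n::finite quad"
  assumes f: "f \<in> erdahl_pos" and h: "h \<in> quad_functions"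
    and nonneg: "\<And>v. v \<in> integer_vectors \<Longrightarrow> quad_eval f v = 0 \<Longrightarrow> quad_eval h v \<ge> 0"
  shows "\<forall>\<^sub>F t in at_right 0. f + t *\<^sub>R h \<in> erdahl_pos"
proof -
  obtain \<epsilon> where \<epsilon>: "\<epsilon> > 0" "\<And>x. \<epsilon> * (norm x)\<^sup>2 \<le> x \<bullet> (qmat f *v x)"
    and fin: "finite {v \<in> integer_vectors. quad_eval f v < \<epsilon> * (1 + (norm v)\<^sup>2)}" (is "finite ?S")
    using finite_integer_small_values[OF erdahl_posD(2)[OF f]] by blast
  obtain M where M: "M > 0" "\<And>x. \<bar>quad_eval h x\<bar> \<le> M * (1 + (norm x)\<^sup>2)"
    "\<And>x. \<bar>x \<bullet> (qmat h *v x)\<bar> \<le> M * (norm x)\<^sup>2"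
    using quad_eval_growth[of h] by blast
  have "\<forall>\<^sub>F t in at_right 0. quad_eval f v + t * quad_eval h v \<ge> 0" if "v \<in> ?S" for v
  proof (cases "quad_eval f v = 0")
    case True
    then show ?thesis using nonneg that
      by (auto intro!: eventually_mono[OF eventually_at_right_less[of 0]])
  next
    case False
    then have "quad_eval f v + 0 * quad_eval h v > 0"
      using erdahl_posD(3)[OF f, of v] that by simp
    moreover have "((\<lambda>t. quad_eval f v + t * quad_eval h v) \<longlongrightarrow> quad_eval f v + 0 * quad_eval h v) (at_right 0)"
      by (intro tendsto_intros)
    ultimately have "\<forall>\<^sub>F t in at_right 0. quad_eval f v + t * quad_eval h v > 0"
      by (rule order_tendstoD(1)[rotated])
    then show ?thesis by (rule eventually_mono) simp
  qed
  then have "\<forall>\<^sub>F t in at_right 0. \<forall>v\<in>?S. quad_eval f v + t * quad_eval h v \<ge> 0"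
    by (intro eventually_ball_finite fin ballI)
  \<comment> \<open>This bound on \<open>t\<close> serves twice: off the finite set, and for
    positive definiteness of the perturbed matrix.\<close>
  moreover have "\<forall>\<^sub>F t in at_right 0. t \<in> {0<..<\<epsilon> / M}"
    using \<epsilon> M by (intro eventually_at_right_real) simp
  ultimately show ?thesis
  proof eventually_elim
    case (elim t)
    have t: "t > 0" "t * M < \<epsilon>" using elim M by (auto simp: field_simps)
    have "quad_eval f v + t * quad_eval h v \<ge> 0" if v: "v \<in> integer_vectors" for v
    proof (cases "v \<in> ?S")
      case False
      have "t * \<bar>quad_eval h v\<bar> \<le> t * M * (1 + (norm v)\<^sup>2)"
        using M(2)[of v] t(1) by (simp add: mult.assoc)
      also have "\<dots> \<le> \<epsilon> * (1 + (norm v)\<^sup>2)"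
        using t(2) by (intro mult_right_mono) auto
      also have "\<dots> \<le> quad_eval f v" using False v by simp
      finally show ?thesis
        using t(1) by (smt (verit) abs_ge_minus_self mult_left_mono mult_minus_right)
    qed (use elim in auto)
    moreover have "x \<bullet> ((qmat f + t *\<^sub>R qmat h) *v x) > 0" if "x \<noteq> 0" for x
    proof -
      have "t * \<bar>x \<bullet> (qmat h *v x)\<bar> \<le> t * M * (norm x)\<^sup>2"
        using M(3)[of x] t(1) by (simp add: mult.assoc)
      also have "\<dots> < \<epsilon> * (norm x)\<^sup>2"
        using t(2) that by (intro mult_strict_right_mono) auto
      also have "\<dots> \<le> x \<bullet> (qmat f *v x)" by (rule \<epsilon>(2))
      finally have "t * \<bar>x \<bullet> (qmat h *v x)\<bar> < x \<bullet> (qmat f *v x)" .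
      moreover have "- (t * \<bar>x \<bullet> (qmat h *v x)\<bar>) \<le> t * (x \<bullet> (qmat h *v x))"
        using t(1) by (smt (verit) abs_ge_minus_self mult_left_mono mult_minus_right)
      ultimately show ?thesis
        by (simp add: matrix_vector_mult_add_rdistrib inner_add_right scaleR_matrix_vector_assoc[symmetric])
    qed
    moreover have "f + t *\<^sub>R h \<in> quad_functions"
      by (intro subspace_add subspace_mul subspace_quad_functions erdahl_posD(1) f h)
    ultimately show ?case
      by (simp add: erdahl_pos_def pos_definite_def quad_functions_def)
  qed
qed

section \<open>Extreme functions\<close>

lemma quad_eval_convex_combination:
  fixes f :: "'n::finite quad"
  assumes "f \<in> quad_functions"
  shows "quad_eval f ((1 - u) *\<^sub>R a + u *\<^sub>R b) =
    (1 - u) * quad_eval f a + u * quad_eval f b - u * (1 - u) * ((a - b) \<bullet> (qmat f *v (a - b)))"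
proof -
  have "a \<bullet> (qmat f *v b) = b \<bullet> (qmat f *v a)"
    using assms by (intro inner_sym_matrix) (simp add: quad_functions_def)
  then show ?thesis
    by (simp add: quad_eval_def matrix_vector_mult_diff_distrib matrix_vector_right_distrib
        matrix_vector_mult_scaleR inner_diff_left inner_diff_right inner_add_left inner_add_right)
      (simp add: algebra_simps)
qed

text \<open>By convexity \<open>f\<close> is at most 0 on the hull, and by strict convexity it is
  negative inside every nondegenerate segment there. Hence no integer zero lies inside such a
  segment.\<close>

lemma vert_Del:
  fixes f :: "'n::finite quad"
  assumes "pos_definite (qmat f)"
  shows "vert (Del f) = {v \<in> integer_vectors. quad_eval f v = 0}" (is "_ = ?Z")
proof
  show "vert (Del f) \<subseteq> ?Z"
    using extreme_point_of_convex_hull by (fastforce simp: vert_def Del_def)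
  have comb: "quad_eval f ((1 - u) *\<^sub>R a + u *\<^sub>R b) \<le> 0"
    and comb_strict: "0 < u \<Longrightarrow> u < 1 \<Longrightarrow> a \<noteq> b \<Longrightarrow> quad_eval f ((1 - u) *\<^sub>R a + u *\<^sub>R b) < 0"
    if "0 \<le> u" "u \<le> 1" "quad_eval f a \<le> 0" "quad_eval f b \<le> 0" for u a b
  proof -
    have "(1 - u) * quad_eval f a + u * quad_eval f b \<le> 0"
      using that by (intro add_nonpos_nonpos mult_nonneg_nonpos) auto
    moreover have "(a - b) \<bullet> (qmat f *v (a - b)) \<ge> 0"
      using pos_definite_pos[OF assms, of "a - b"] by (cases "a = b") auto
    then have "u * (1 - u) * ((a - b) \<bullet> (qmat f *v (a - b))) \<ge> 0"
      using that by simp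
    moreover have "u * (1 - u) * ((a - b) \<bullet> (qmat f *v (a - b))) > 0" if "0 < u" "u < 1" "a \<noteq> b"
      using pos_definite_pos[OF assms, of "a - b"] that by simp
    ultimately show "quad_eval f ((1 - u) *\<^sub>R a + u *\<^sub>R b) \<le> 0"
      "0 < u \<Longrightarrow> u < 1 \<Longrightarrow> a \<noteq> b \<Longrightarrow> quad_eval f ((1 - u) *\<^sub>R a + u *\<^sub>R b) < 0"
      using quad_eval_convex_combination[OF pos_definite_quad_functions[OF assms], of u a b]
      by linarith+
  qed
  have "convex {x. quad_eval f x \<le> 0}"
    using comb by (auto simp: convex_alt)
  then have "convex hull ?Z \<subseteq> {x. quad_eval f x \<le> 0}"
    by (intro hull_minimal) auto
  then have hull: "quad_eval f x \<le> 0" if "x \<in> convex hull ?Z" for x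
    using that by blast
  have "z \<notin> open_segment a b" if "z \<in> ?Z" "a \<in> convex hull ?Z" "b \<in> convex hull ?Z" for z a b
  proof
    assume "z \<in> open_segment a b"
    then obtain u where "0 < u" "u < 1" "a \<noteq> b" "z = (1 - u) *\<^sub>R a + u *\<^sub>R b"
      by (auto simp: in_segment)
    then show False
      using comb_strict[of u a b] hull[OF that(2)] hull[OF that(3)] that(1) by simp
  qed
  then show "?Z \<subseteq> vert (Del f)"
    by (auto simp: vert_def Del_def extreme_point_of_def intro: hull_inc)
qed

section \<open>Consequences of local maximality along rays\<close>

lemma extreme_pos_definite: "extreme f \<Longrightarrow> pos_definite (qmat f)"
  by (simp add: extreme_def erdahl_pos_def)

text \<open>Reduces the local maximum to one comparison along a ray; a single \<open>t\<close>
  suffices because the tangent inequality is global.\<close>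

lemma extreme_hermite_le:
  fixes f h :: "'n::finite quad"
  assumes f: "extreme f" and h: "h \<in> quad_functions" "h \<noteq> 0"
    and nonneg: "\<And>v. v \<in> integer_vectors \<Longrightarrow> quad_eval f v = 0 \<Longrightarrow> quad_eval h v \<ge> 0"
  obtains t where "t > 0" "f + t *\<^sub>R h \<in> erdahl_pos" "hermite (f + t *\<^sub>R h) \<le> hermite f"
proof -
  have "\<forall>\<^sub>F t in at_right 0. f + t *\<^sub>R h \<in> erdahl_pos"
    using f h nonneg by (intro eventually_erdahl_pos) (auto simp: extreme_def)
  moreover have pos: "\<forall>\<^sub>F t::real in at_right 0. t > 0"
    by (rule eventually_at_right_less)
  moreover have "\<forall>\<^sub>F t in at_right 0. f + t *\<^sub>R h \<in> erdahl_pos \<longrightarrow> hermite (f + t *\<^sub>R h) \<le> hermite f"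
  proof -
    have "((\<lambda>t. f + t *\<^sub>R h) \<longlongrightarrow> f + 0 *\<^sub>R h) (at_right 0)"
      by (intro tendsto_intros)
    \<comment> \<open>The filter \<open>at f\<close> excludes \<open>f\<close> itself, so the ray
      must actually leave it; this is where \<open>h\<close> being nonzero enters.\<close>
    moreover have "\<forall>\<^sub>F t in at_right 0. f + t *\<^sub>R h \<noteq> f"
      using pos by (rule eventually_mono) (use h in auto)
    ultimately have "filterlim (\<lambda>t. f + t *\<^sub>R h) (at f) (at_right 0)"
      by (simp add: filterlim_at)
    moreover have "\<forall>\<^sub>F g in at f. g \<in> erdahl_pos \<longrightarrow> hermite g \<le> hermite f"
      using f by (auto simp: extreme_def eventually_at_filter elim: eventually_mono)
    ultimately show ?thesis
      by (rule eventually_compose_filterlim[rotated])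
  qed
  ultimately have "\<forall>\<^sub>F t in at_right 0. t > 0 \<and> f + t *\<^sub>R h \<in> erdahl_pos \<and> hermite (f + t *\<^sub>R h) \<le> hermite f"
    by eventually_elim auto
  then show thesis
    using that eventually_happens'[OF trivial_limit_at_right_real] by blast
qed

text \<open>If \<open>qmu f \<le> 0\<close> then the only possible integer zero of \<open>f\<close> is its center, so adding a small
  linear form that vanishes at the center keeps \<open>f\<close> in the cone and lowers its minimum.\<close>

lemma extreme_qmu_pos:
  fixes f :: "'n::finite quad"
  assumes "extreme f"
  shows "qmu f > 0"
proof (rule ccontr)
  assume neg: "\<not> qmu f > 0"
  have f: "pos_definite (qmat f)" by (rule extreme_pos_definite[OF assms(1)])
  define l :: "real^'n" where "l = axis undefined 1"
  have l: "l \<noteq> 0" by (simp add: l_def axis_eq_0_iff)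
  define h :: "'n quad" where "h = (- 2 * (l \<bullet> qcenter f), l, 0)"
  have h: "quad_eval h x = 2 * (l \<bullet> (x - qcenter f))" for x
    by (simp add: quad_eval_def h_def qconst_def qlin_def qmat_def inner_diff_right)
  have "h \<in> quad_functions" "h \<noteq> 0" "qmat h = 0"
    using l by (auto simp: h_def quad_functions_def qmat_def transpose_def vec_eq_iff prod_eq_iff)
  moreover have "quad_eval h v \<ge> 0" if "quad_eval f v = 0" for v
    using that neg quad_eval_ge_qmu[OF f, of v] by (simp add: h)
  ultimately obtain t where t: "t > 0" "hermite (f + t *\<^sub>R h) \<le> hermite f"
    using extreme_hermite_le[OF assms] by metis
  let ?g = "f + t *\<^sub>R h"
  have g: "pos_definite (qmat ?g)" using f \<open>qmat h = 0\<close> by simp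
  \<comment> \<open>The matrix is unchanged, so the Hermite invariants compare minima. As
    \<open>?g\<close> keeps its value at the old center, that center remains the minimizer, forcing
    the linear part to be unchanged: a contradiction.\<close>
  have "qmu ?g \<le> qmu f"
    using t(2) root_det_pos[OF f] \<open>qmat h = 0\<close> by (simp add: hermite_root_det divide_le_cancel)
  moreover have "quad_eval ?g (qcenter f) = - qmu f"
    by (simp add: quad_eval_qcenter[OF f] h)
  ultimately have "qcenter ?g = qcenter f"
    using quad_eval_ge_qmu[OF g, of "qcenter f"] by simp
  then have "qlin ?g = qlin f"
    using qmat_qcenter[OF g] qmat_qcenter[OF f] \<open>qmat h = 0\<close> by simp
  then show False using t(1) l by (simp add: h_def qlin_def)
qed

text \<open>At \<open>?g\<close> extremality gives \<open>\<kappa> D - \<mu> \<ge> 0\<close>, while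
  \<open>le\<close> makes the pairing of \<open>?g\<close> with the normal nonpositive, since
  \<open>f\<close> itself pairs to zero. The tangent inequality squeezes both to 0, and its equality
  case applies.\<close>

lemma extreme_cone_trivial:
  fixes f h :: "'n::finite quad"
  assumes "extreme f" and h: "h \<in> quad_functions"
    and nonneg: "\<And>v. v \<in> integer_vectors \<Longrightarrow> quad_eval f v = 0 \<Longrightarrow> quad_eval h v \<ge> 0"
    and le: "hermite_normal (hermite f) f \<bullet> qdual h \<le> 0"
  shows "\<exists>r. h = r *\<^sub>R f"
proof (cases "h = 0")
  case True
  then show ?thesis by (intro exI[of _ 0]) simp
next
  case False
  have f: "pos_definite (qmat f)" by (rule extreme_pos_definite[OF assms(1)])
  have H: "hermite f > 0"
    using extreme_qmu_pos[OF assms(1)] root_det_pos[OF f] by (simp add: hermite_root_det)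
  obtain t where t: "t > 0" "f + t *\<^sub>R h \<in> erdahl_pos" "hermite (f + t *\<^sub>R h) \<le> hermite f"
    using extreme_hermite_le[OF assms(1) h False nonneg] by metis
  let ?g = "f + t *\<^sub>R h"
  have g: "pos_definite (qmat ?g)" using t(2) by (rule erdahl_posD)
  have "qmu ?g \<le> hermite f * root_det (qmat ?g)"
    using t(3) hermite_le_iff[OF g] by simp
  moreover have "hermite_normal (hermite f) f \<bullet> qdual ?g \<le> 0"
    using le t(1) hermite_normal_inner_self[OF f, of "hermite f"] qmu_eq_hermite[OF f]
    by (simp add: linear_add[OF linear_qdual] linear_scale[OF linear_qdual] inner_add_right
        mult_nonneg_nonpos)
  moreover have "hermite_normal (hermite f) f \<bullet> qdual ?g \<ge> hermite f * root_det (qmat ?g) - qmu ?g"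
    using H by (intro hermite_normal_inner_ge(1) f g) simp
  ultimately have eq: "hermite_normal (hermite f) f \<bullet> qdual ?g = hermite f * root_det (qmat ?g) - qmu ?g"
    and mu: "qmu ?g = hermite f * root_det (qmat ?g)"
    by linarith+
  obtain s where s: "s > 0" "qmat ?g = s *\<^sub>R qmat f" and c: "qcenter f = qcenter ?g"
    using hermite_normal_inner_ge(2)[OF g f less_imp_le[OF H] H eq] by blast
  have "qmu ?g = s * qmu f"
    using mu s by (simp add: root_det_scaleR qmu_eq_hermite[OF f])
  then have "?g = s *\<^sub>R f"
    using c s by (intro eq_scaleR_quadI g f) auto
  then have "h = ((s - 1) / t) *\<^sub>R f"
    using t(1) by (metis (no_types, opaque_lifting) add_diff_cancel_left' divide_inverse_commute
        less_numeral_extra(3) scaleR_left.diff scaleR_one scaleR_scaleR left_inverse)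
  then show ?thesis ..
qed

section \<open>Eutaxy by separation\<close>

lemma subspace_inner_kernel: "subspace S \<Longrightarrow> subspace {y \<in> S. y \<bullet> a = 0}"
  by (simp add: subspace_def inner_add_left)

text \<open>If the normal \<open>w\<close> is not a positive combination of evaluations, a
  separating functional yields an \<open>h\<close> to which \<open>extreme_cone_trivial\<close>
  applies. Then \<open>h\<close> is a multiple of \<open>f\<close>, yet the functional is orthogonal
  to \<open>qdual f\<close>.\<close>

lemma extreme_eutactic:
  fixes f :: "'n::finite quad"
  assumes "extreme f"
  shows "eutactic f"
proof -
  have fE: "f \<in> erdahl_pos" using assms by (simp add: extreme_def)
  have f: "pos_definite (qmat f)" using fE by (rule erdahl_posD)
  define Z where "Z = vert (Del f)"
  have Z: "Z = {v \<in> integer_vectors. quad_eval f v = 0}" unfolding Z_def by (rule vert_Del[OF f])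
  have fin: "finite Z" unfolding Z_def by (rule finite_vert_Del[OF fE])
  define w where "w = hermite_normal (hermite f) f"
  have w: "w = ev (qcenter f) + quad_of_matrix ((qmu f / CARD('n)) *\<^sub>R matrix_inv (qmat f))"
    using qmu_eq_hermite[OF f] by (simp add: w_def hermite_normal_def)
  define comb where "comb \<alpha> = (\<Sum>v\<in>Z. \<alpha> v *\<^sub>R ev v)" for \<alpha> :: "real^'n \<Rightarrow> real"
  define K where "K = comb ` {\<alpha>. \<forall>v\<in>Z. \<alpha> v > 0}"
  have comb_inner: "a \<bullet> comb \<alpha> = (\<Sum>v\<in>Z. \<alpha> v * (a \<bullet> ev v))" for a \<alpha>
    by (simp add: comb_def inner_sum_right)
  have "w \<in> K"
  proof (rule ccontr)
    assume "w \<notin> K"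
    have "convex K"
    proof (rule convexI)
      fix x y and u v :: real assume "x \<in> K" "y \<in> K" and uv: "0 \<le> u" "0 \<le> v" "u + v = 1"
      then obtain \<alpha> \<beta> where "x = comb \<alpha>" "y = comb \<beta>" and pos: "\<forall>v\<in>Z. \<alpha> v > 0" "\<forall>v\<in>Z. \<beta> v > 0"
        by (auto simp: K_def)
      then have "u *\<^sub>R x + v *\<^sub>R y = comb (\<lambda>z. u * \<alpha> z + v * \<beta> z)"
        by (simp add: comb_def scaleR_sum_right sum.distrib algebra_simps)
      moreover have "u * \<alpha> z + v * \<beta> z > 0" if "z \<in> Z" for z
        using that pos uv
        by (cases "u = 0") (auto intro!: add_pos_nonneg mult_nonneg_nonneg simp: less_imp_le)
      ultimately show "u *\<^sub>R x + v *\<^sub>R y \<in> K" by (auto simp: K_def)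
    qed
    moreover have "comb (\<lambda>_. 1) \<in> K" by (auto simp: K_def)
    \<comment> \<open>\<open>K\<close> need not be closed, so the separation is weak. Choosing
      \<open>a\<close> among the directions of the affine hull keeps it from being constant
      there.\<close>
    ultimately obtain a b where a: "w + a \<in> affine hull (insert w K)" "a \<noteq> 0" "a \<bullet> w \<le> b"
      "\<And>x. x \<in> K \<Longrightarrow> a \<bullet> x \<ge> b"
      using separating_hyperplane_set_point_inaff[of K w] \<open>w \<notin> K\<close> by (metis empty_iff)
    have ab: "b \<le> (\<Sum>v\<in>Z. \<alpha> v * (a \<bullet> ev v))" if "\<forall>v\<in>Z. \<alpha> v > 0" for \<alpha>
      using a(4)[of "comb \<alpha>"] that by (auto simp: comb_inner K_def)
    \<comment> \<open>All coefficients are sent to zero together.\<close>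
    have "b \<le> 0"
    proof -
      have "((\<lambda>s. s * (a \<bullet> comb (\<lambda>_. 1))) \<longlongrightarrow> 0 * (a \<bullet> comb (\<lambda>_. 1))) (at_right 0)"
        by (intro tendsto_intros)
      moreover have "\<forall>\<^sub>F s in at_right 0. b \<le> s * (a \<bullet> comb (\<lambda>_. 1))"
        using eventually_at_right_less[of "0::real"]
        by (rule eventually_mono) (use ab[of "\<lambda>_. s" for s] in \<open>simp add: comb_inner sum_distrib_left\<close>)
      ultimately show ?thesis
        using tendsto_lowerbound trivial_limit_at_right_real by fastforce
    qed
    have a_ev: "a \<bullet> ev z \<ge> 0" if "z \<in> Z" for z
    proof (rule ccontr)
      assume neg: "\<not> a \<bullet> ev z \<ge> 0"
      define c where "c = a \<bullet> ev z"
      define d where "d = (\<Sum>v\<in>Z - {z}. a \<bullet> ev v)"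
      \<comment> \<open>A coefficient at \<open>z\<close> so large that \<open>k * c + d\<close>
        falls below \<open>b\<close>.\<close>
      define k where "k = (\<bar>b\<bar> + \<bar>d\<bar> + 1) / \<bar>c\<bar>"
      have c: "c < 0" using neg by (simp add: c_def)
      have k: "k > 0" unfolding k_def using c by (intro divide_pos_pos) auto
      then have "b \<le> (\<Sum>v\<in>Z. (if v = z then k else 1) * (a \<bullet> ev v))" by (intro ab) auto
      also have "\<dots> = k * c + d"
        using fin that by (simp add: sum.remove[of Z z] c_def d_def)
      also have "k * c = - (\<bar>b\<bar> + \<bar>d\<bar> + 1)" using c by (simp add: k_def)
      finally show False by linarith
    qed
    \<comment> \<open>A subspace containing \<open>w\<close> and \<open>K\<close>, hence also the
      direction \<open>a\<close>. Its symmetry makes \<open>h\<close> a quadratic function, its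
      orthogonality rules out multiples of \<open>qdual f\<close>.\<close>
    let ?L = "{y \<in> quad_functions. y \<bullet> qdual f = 0}"
    have w0: "w \<bullet> qdual f = 0"
      using hermite_normal_inner_self[OF f, of "hermite f"] qmu_eq_hermite[OF f] by (simp add: w_def)
    have "matrix_inv (qmat f) = transpose (matrix_inv (qmat f))"
    proof (rule matrix_inv_eqI)
      show "transpose (matrix_inv (qmat f)) ** qmat f = mat 1"
        using matrix_inv_cancel(1)[of "qmat f"] pos_definite_det_pos[OF f] pos_definite_sym[OF f]
        by (metis less_irrefl matrix_transpose_mul transpose_mat)
    qed
    then have "quad_of_matrix (r *\<^sub>R matrix_inv (qmat f)) \<in> quad_functions" for r
      by (simp add: quad_functions_def quad_of_matrix_def qmat_def transpose_scaleR)
    then have "w \<in> quad_functions"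
      unfolding w by (intro subspace_add[OF subspace_quad_functions] ev_in_quad_functions)
    moreover have "K \<subseteq> quad_functions"
      by (auto simp: K_def comb_def intro!: subspace_sum subspace_mul subspace_quad_functions
          ev_in_quad_functions)
    moreover have "x \<bullet> qdual f = 0" if "x \<in> K" for x
      using that by (auto simp: K_def comb_def inner_sum_left ev_inner_qdual Z)
    ultimately have "insert w K \<subseteq> ?L" using w0 by auto
    moreover
    have L: "subspace ?L"
      by (rule subspace_inner_kernel[OF subspace_quad_functions])
    ultimately have "affine hull (insert w K) \<subseteq> ?L"
      by (intro hull_minimal subspace_imp_affine)
    then have "w + a \<in> ?L" "w \<in> ?L"
      using a(1) hull_inc[of w "insert w K" affine] by blast+
    then have aL: "a \<in> ?L" using subspace_diff[OF L, of "w + a" w] by simp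
    \<comment> \<open>Halving the linear part inverts \<open>qdual\<close>.\<close>
    define h where "h = (qconst a, (1/2) *\<^sub>R qlin a, qmat a)"
    have ah: "qdual h = a"
      by (simp add: qdual_def h_def qconst_def qlin_def qmat_def)
    have "\<exists>r. h = r *\<^sub>R f"
    proof (rule extreme_cone_trivial[OF assms])
      show "h \<in> quad_functions" using aL by (simp add: quad_functions_def h_def qmat_def)
      show "hermite_normal (hermite f) f \<bullet> qdual h \<le> 0"
        using a(3) \<open>b \<le> 0\<close> by (simp add: ah w_def[symmetric] inner_commute)
      show "quad_eval h v \<ge> 0" if "v \<in> integer_vectors" "quad_eval f v = 0" for v
        using a_ev[of v] that ev_inner_qdual[of v h] by (simp add: ah Z inner_commute)
    qed
    then obtain r where "a = r *\<^sub>R qdual f"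
      using ah by (metis linear_scale[OF linear_qdual])
    then have "a \<bullet> a = 0" using aL by (simp add: inner_commute)
    then show False using a(2) by simp
  qed
  then show ?thesis
    unfolding eutactic_def w[symmetric] Z_def[symmetric] by (auto simp: K_def comb_def)
qed

section \<open>Perfection and the converse\<close>

text \<open>A symmetric matrix is a function of the unordered pair \<open>{i, j}\<close>, i.e. of a subset with one
  or two elements.\<close>

lemma dim_symmetric_matrices:
  "dim {M :: real^'n::finite^'n. transpose M = M} = CARD('n) + (CARD('n) choose 2)"
proof -
  define P :: "'n set set" where "P = {X. card X = 1 \<or> card X = 2}"
  \<comment> \<open>The 0/1 matrix supported on the positions of one unordered pair; distinct pairs
    have disjoint supports, hence orthogonal matrices.\<close>
  define S :: "'n set \<Rightarrow> real^'n^'n" where "S X = (\<chi> i j. if {i, j} = X then 1 else 0)" for X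
  have inP: "{i, j} \<in> P" for i j :: 'n by (simp add: P_def card_insert_if)
  have pairs: "\<exists>i j. X = {i, j}" if "X \<in> P" for X :: "'n set"
    using that unfolding P_def by (auto simp: card_1_singleton_iff card_2_iff)
  have S_orth: "S X \<bullet> S Y = 0" if "X \<noteq> Y" for X Y
  proof -
    have z: "S X $ i $ j * S Y $ i $ j = 0" for i j
      using that by (simp add: S_def)
    show ?thesis by (simp add: inner_vec_def z)
  qed
  have S_nz: "S X \<noteq> 0" if X: "X \<in> P" for X
  proof -
    obtain i j where "X = {i, j}" using pairs[OF X] by blast
    then have "S X $ i $ j = 1" by (simp add: S_def)
    then show ?thesis by auto
  qed
  have inj: "inj_on S P"
    using S_orth S_nz by (metis inj_onI inner_eq_zero_iff)
  have "pairwise orthogonal (S ` P)"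
    by (intro pairwise_imageI) (metis orthogonal_def S_orth)
  then have indep: "independent (S ` P)"
    using S_nz by (intro pairwise_orthogonal_independent) auto
  have span: "{M. transpose M = M} \<subseteq> span (S ` P)"
  proof
    fix M :: "real^'n^'n" assume M: "M \<in> {M. transpose M = M}"
    then have sym: "M $ i $ j = M $ j $ i" for i j by (auto simp: transpose_def vec_eq_iff)
    \<comment> \<open>The choice is unambiguous: \<open>{i, j}\<close> determines the pair up to a
      swap, under which \<open>M\<close> is symmetric.\<close>
    define m where "m X = (SOME r. \<exists>i j. X = {i, j} \<and> r = M $ i $ j)" for X
    have m: "m {i, j} = M $ i $ j" for i j
      unfolding m_def using sym by (intro some_equality) (auto simp: doubleton_eq_iff)
    have "M = (\<Sum>X\<in>P. m X *\<^sub>R S X)"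
    proof -
      have "M $ i $ j = (\<Sum>X\<in>P. m X *\<^sub>R S X) $ i $ j" for i j
      proof -
        have "(\<Sum>X\<in>P. m X *\<^sub>R S X) $ i $ j = (\<Sum>X\<in>P. m X * (if {i, j} = X then 1 else 0))"
          by (simp only: S_def sum_component vector_scaleR_component vec_lambda_beta real_scaleR_def)
        also have "\<dots> = (\<Sum>X\<in>P. if {i, j} = X then m X else 0)"
          by (intro sum.cong) auto
        also have "\<dots> = m {i, j}" using inP[of i j] by (simp add: sum.delta' finite)
        finally show ?thesis by (simp add: m)
      qed
      then show ?thesis by (simp add: vec_eq_iff)
    qed
    also have "\<dots> \<in> span (S ` P)" by (intro span_sum span_scale span_base imageI)
    finally show "M \<in> span (S ` P)" .
  qed
  have sub: "S ` P \<subseteq> {M. transpose M = M}"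
    by (auto simp: S_def transpose_def vec_eq_iff insert_commute)
  have "card P = card {X :: 'n set. card X = 1} + card {X :: 'n set. card X = 2}"
    unfolding P_def by (subst card_Un_disjoint[symmetric]) (auto intro!: arg_cong[where f=card])
  also have "\<dots> = CARD('n) + (CARD('n) choose 2)"
    using n_subsets[of "UNIV :: 'n set" 1] n_subsets[of "UNIV :: 'n set" 2] by simp
  finally have "card (S ` P) = CARD('n) + (CARD('n) choose 2)"
    using card_image[OF inj] by simp
  then show ?thesis
    using dim_unique[OF sub span indep] by simp
qed

lemma dim_quad_functions:
  "dim (quad_functions :: 'n::finite quad set) = (CARD('n) + 2) choose 2"
proof -
  have eq: "quad_functions = (UNIV :: real set) \<times> (UNIV :: (real^'n) set) \<times> {M. transpose M = M}"
    by (auto simp: quad_functions_def qmat_def)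
  have sub: "subspace {M :: real^'n^'n. transpose M = M}"
    by (auto simp: subspace_def transpose_def vec_eq_iff)
  have "dim (quad_functions :: 'n quad set) = 1 + (CARD('n) + (CARD('n) + (CARD('n) choose 2)))"
    unfolding eq by (subst dim_Times subspace_Times | simp add: sub dim_symmetric_matrices subspace_Times)+
  then show ?thesis by (simp add: numeral_2_eq_2)
qed

section \<open>Perfection as uniqueness of \<open>f\<close> up to scale\<close>

lemma subspace_orthogonal_in: "subspace S \<Longrightarrow> subspace {y \<in> S. \<forall>x\<in>A. orthogonal x y}"
  by (simp add: subspace_def orthogonal_def inner_add_right)

text \<open>Under \<open>qdual\<close>, the functions vanishing at all vertices form the orthogonal
  complement \<open>C\<close> of the span of the evaluations. \<open>C\<close> contains the nonzero
  \<open>qdual f\<close>, so codimension one means that \<open>C\<close> is the line through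
  it.\<close>

lemma perfect_iff:
  fixes f :: "'n::finite quad"
  assumes f: "pos_definite (qmat f)"
  shows "perfect f \<longleftrightarrow>
    (\<forall>h\<in>quad_functions. (\<forall>v\<in>vert (Del f). quad_eval h v = 0) \<longrightarrow> (\<exists>r. h = r *\<^sub>R f))"
proof -
  define V where "V = span (ev ` vert (Del f))"
  define C where "C = {y \<in> quad_functions. \<forall>x\<in>V. orthogonal x y}"
  have V: "subspace V" "V \<subseteq> quad_functions"
    unfolding V_def
    by (rule subspace_span) (intro span_minimal image_subsetI subspace_quad_functions ev_in_quad_functions)
  have dims: "dim C + dim V = (CARD('n) + 2) choose 2"
    unfolding C_def dim_quad_functions[symmetric]
    by (intro dim_subspace_orthogonal_to_vectors V subspace_quad_functions)
  have C_iff: "qdual h \<in> C \<longleftrightarrow> h \<in> quad_functions \<and> (\<forall>v\<in>vert (Del f). quad_eval h v = 0)" for h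
  proof -
    have "(\<forall>x\<in>V. orthogonal x (qdual h)) \<longleftrightarrow> (\<forall>x\<in>ev ` vert (Del f). orthogonal x (qdual h))"
      unfolding V_def
      by (auto simp: span_base orthogonal_commute[of _ "qdual h"] intro: orthogonal_to_span)
    then show ?thesis
      by (simp add: C_def orthogonal_def ev_inner_qdual) (simp add: quad_functions_def qdual_def qmat_def)
  qed
  have subspace_C: "subspace C"
    unfolding C_def by (rule subspace_orthogonal_in[OF subspace_quad_functions])
  have qdual_surj: "\<exists>h. k = qdual h" for k :: "'n quad"
    by (rule exI[of _ "(qconst k, (1/2) *\<^sub>R qlin k, qmat k)"])
      (simp add: qdual_def qconst_def qlin_def qmat_def)
  have fC: "qdual f \<in> C"
    using C_iff f by (auto simp: pos_definite_quad_functions vert_Del)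
  have "f \<noteq> 0"
    using pos_definite_pos[OF f, of "axis undefined 1"] by (auto simp: axis_eq_0_iff)
  then have f_nz: "qdual f \<noteq> 0"
    by (metis linear_0[OF linear_qdual] qdual_inject)
  have "perfect f \<longleftrightarrow> dim V = ((CARD('n) + 2) choose 2) - 1"
    by (simp add: perfect_def V_def)
  \<comment> \<open>The natural-number subtraction does not truncate, as the binomial coefficient is
    positive.\<close>
  also have "\<dots> \<longleftrightarrow> dim C = 1"
    using dims by (auto simp: numeral_2_eq_2)
  also have "\<dots> \<longleftrightarrow> C \<subseteq> span {qdual f}"
  proof
    assume "dim C = 1"
    then show "C \<subseteq> span {qdual f}"
      using subspace_C fC f_nz
      by (intro card_ge_dim_independent) (auto simp: dependent_single)
  next
    assume "C \<subseteq> span {qdual f}"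
    from dim_le_card[OF this] have "dim C \<le> 1" by simp
    moreover have "dim C \<noteq> 0" using fC f_nz by (auto simp: dim_eq_0)
    ultimately show "dim C = 1" by linarith
  qed
  also have "\<dots> \<longleftrightarrow> (\<forall>h. qdual h \<in> C \<longrightarrow> (\<exists>r. h = r *\<^sub>R f))"
  proof -
    have in_span: "qdual h \<in> span {qdual f} \<longleftrightarrow> (\<exists>r. h = r *\<^sub>R f)" for h
      by (auto simp: span_singleton linear_scale[OF linear_qdual, symmetric] qdual_inject)
    show ?thesis
    proof (intro iffI allI impI subsetI)
      show "\<exists>r. h = r *\<^sub>R f" if "C \<subseteq> span {qdual f}" "qdual h \<in> C" for h
        using that in_span by blast
    next
      fix k assume *: "\<forall>h. qdual h \<in> C \<longrightarrow> (\<exists>r. h = r *\<^sub>R f)" and "k \<in> C"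
      obtain h where "k = qdual h" using qdual_surj by blast
      with * \<open>k \<in> C\<close> in_span[of h] show "k \<in> span {qdual f}" by blast
    qed
  qed
  finally show ?thesis unfolding C_iff by blast
qed

section \<open>Continuity of the normal\<close>

lemma tendsto_det:
  fixes F :: "'a \<Rightarrow> real^'n::finite^'n"
  assumes "(F \<longlongrightarrow> A) net"
  shows "((\<lambda>x. det (F x)) \<longlongrightarrow> det A) net"
  unfolding det_def by (intro tendsto_intros assms)

text \<open>Expresses the inverse through quotients of determinants, from which its continuity
  follows.\<close>

lemma matrix_inv_cramer:
  fixes A :: "real^'n::finite^'n"
  assumes "det A \<noteq> 0"
  shows "matrix_inv A *v b = (\<chi> k. det (\<chi> i j. if j = k then b $ i else A $ i $ j) / det A)"
proof -
  have "A *v (matrix_inv A *v b) = b"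
    using assms by (simp add: matrix_vector_mul_assoc matrix_inv_cancel)
  then show ?thesis using cramer[OF assms] by blast
qed

lemma tendsto_matrix_vector_mult:
  fixes F :: "'a \<Rightarrow> real^'n::finite^'m::finite"
  assumes "(F \<longlongrightarrow> A) net" "(G \<longlongrightarrow> b) net"
  shows "((\<lambda>x. F x *v G x) \<longlongrightarrow> A *v b) net"
  unfolding matrix_vector_mult_def by (intro tendsto_intros assms)

lemma tendsto_matrix_inv:
  fixes F :: "'a \<Rightarrow> real^'n::finite^'n"
  assumes F: "(F \<longlongrightarrow> A) net" and A: "det A \<noteq> 0"
  shows "((\<lambda>x. matrix_inv (F x)) \<longlongrightarrow> matrix_inv A) net"
proof (intro vec_tendstoI)
  fix i j :: 'n
  have entry: "B $ i $ j = (B *v axis j 1) $ i" for B :: "real^'n^'n"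
    by (simp add: matrix_vector_mult_basis column_def)
  let ?c = "\<lambda>B :: real^'n^'n. det (\<chi> k l. if l = i then axis j 1 $ k else B $ k $ l) / det B"
  have c: "matrix_inv B $ i $ j = ?c B" if "det B \<noteq> 0" for B
    unfolding entry[of "matrix_inv B"] matrix_inv_cramer[OF that] by simp
  have "((\<lambda>x. \<chi> k l. if l = i then axis j 1 $ k else F x $ k $ l) \<longlongrightarrow>
      (\<chi> k l. if l = i then axis j 1 $ k else A $ k $ l)) net"
    by (intro vec_tendstoI) (auto intro!: tendsto_intros F)
  then have "((\<lambda>x. ?c (F x)) \<longlongrightarrow> ?c A) net"
    by (intro tendsto_divide tendsto_det F A)
  \<comment> \<open>The quotient formula is valid only for invertible matrices, which the values of
    \<open>F\<close> eventually are.\<close>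
  moreover have "\<forall>\<^sub>F x in net. det (F x) \<noteq> 0"
    using tendsto_det[OF F] A by (rule tendsto_imp_eventually_ne)
  then have "\<forall>\<^sub>F x in net. ?c (F x) = matrix_inv (F x) $ i $ j"
    by (rule eventually_mono) (simp add: c)
  ultimately show "((\<lambda>x. matrix_inv (F x) $ i $ j) \<longlongrightarrow> matrix_inv A $ i $ j) net"
    unfolding c[OF A] by (rule Lim_transform_eventually)
qed

lemma tendsto_hermite_normal:
  fixes f :: "'n::finite quad"
  assumes "pos_definite (qmat f)"
  shows "(hermite_normal \<kappa> \<longlongrightarrow> hermite_normal \<kappa> f) (at f within S)"
proof -
  have det: "det (qmat f) \<noteq> 0" using pos_definite_det_pos[OF assms] by simp
  have Q: "(qmat \<longlongrightarrow> qmat f) (at f within S)"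
    unfolding qmat_def by (intro tendsto_intros)
  have b: "(qlin \<longlongrightarrow> qlin f) (at f within S)"
    unfolding qlin_def by (intro tendsto_intros)
  have inv: "((\<lambda>g. matrix_inv (qmat g)) \<longlongrightarrow> matrix_inv (qmat f)) (at f within S)"
    by (rule tendsto_matrix_inv[OF Q det])
  have c: "(qcenter \<longlongrightarrow> qcenter f) (at f within S)"
    unfolding qcenter_def by (intro tendsto_intros tendsto_matrix_vector_mult inv b)
  show ?thesis
    unfolding hermite_normal_def ev_def quad_of_matrix_def root_det_def
    by (intro tendsto_intros tendsto_vec_lambda c inv tendsto_det Q) auto
qed

section \<open>Perfect and eutactic functions are extreme\<close>

lemma homogeneous_lower_bound:
  fixes p :: "'a::euclidean_space \<Rightarrow> real"
  assumes V: "subspace V" and p: "continuous_on UNIV p"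
    and hom: "\<And>r x. r \<ge> 0 \<Longrightarrow> p (r *\<^sub>R x) = r * p x"
    and pos: "\<And>x. x \<in> V \<Longrightarrow> x \<noteq> 0 \<Longrightarrow> p x > 0"
  obtains d where "d > 0" "\<And>x. x \<in> V \<Longrightarrow> d * norm x \<le> p x"
proof (cases "V \<inter> sphere 0 1 = {}")
  case True
  \<comment> \<open>Without unit vectors \<open>V\<close> is the zero space, so any constant
    works.\<close>
  have "x = 0" if "x \<in> V" for x
  proof (rule ccontr)
    assume "x \<noteq> 0"
    then have "x /\<^sub>R norm x \<in> V \<inter> sphere 0 1" using subspace_mul[OF V that] by simp
    then show False using True by blast
  qed
  then show thesis using hom[of 0 0] by (intro that[of 1]) force+
next
  case False
  have "compact (V \<inter> sphere 0 1)"
    by (intro closed_Int_compact closed_subspace V compact_sphere)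
  \<comment> \<open>The minimum over the unit sphere of \<open>V\<close> is the constant;
    homogeneity extends the bound to all of \<open>V\<close>.\<close>
  then obtain u where u: "u \<in> V \<inter> sphere 0 1" "\<And>x. x \<in> V \<inter> sphere 0 1 \<Longrightarrow> p u \<le> p x"
    using continuous_attains_inf[OF _ False, of p] continuous_on_subset[OF p subset_UNIV] by blast
  have "u \<noteq> 0" using u(1) by auto
  then have "p u > 0" using u(1) by (intro pos) auto
  moreover have "p u * norm x \<le> p x" if "x \<in> V" for x
  proof (cases "x = 0")
    case True
    then show ?thesis using hom[of 0 0] by simp
  next
    case False
    then have "x /\<^sub>R norm x \<in> V \<inter> sphere 0 1" using subspace_mul[OF V that] by simp
    then have "p u * norm x \<le> p (x /\<^sub>R norm x) * norm x"
      by (intro mult_right_mono u(2)) auto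
    also have "\<dots> = p x" using False hom[of "inverse (norm x)" x] by simp
    finally show ?thesis .
  qed
  ultimately show thesis by (rule that)
qed

text \<open>A nearby \<open>g\<close> is split as \<open>h + t f\<close> with \<open>h\<close>
  orthogonal to \<open>f\<close>. Perfection makes the pairing of \<open>w f\<close> with
  \<open>h\<close> at least \<open>d * norm h\<close>, enough to absorb replacing \<open>w f\<close>
  by \<open>w g\<close>; the part along \<open>f\<close> is handled by the tangent inequality at
  \<open>g\<close>.\<close>

lemma perfect_eutactic_extreme:
  fixes f :: "'n::finite quad"
  assumes fE: "f \<in> erdahl_pos" and "perfect f" "eutactic f"
  shows "extreme f"
proof -
  have f: "pos_definite (qmat f)" using fE by (rule erdahl_posD)
  define Z where "Z = vert (Del f)"
  have Z: "Z = {v \<in> integer_vectors. quad_eval f v = 0}" unfolding Z_def by (rule vert_Del[OF f])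
  have fin: "finite Z" unfolding Z_def by (rule finite_vert_Del[OF fE])
  have span: "\<exists>r. h = r *\<^sub>R f" if "h \<in> quad_functions" "\<And>v. v \<in> Z \<Longrightarrow> quad_eval h v = 0" for h
    using \<open>perfect f\<close> that unfolding perfect_iff[OF f] Z_def by blast
  define w :: "'n quad \<Rightarrow> 'n quad" where "w = hermite_normal (hermite f)"
  obtain \<alpha> where \<alpha>: "\<And>v. v \<in> Z \<Longrightarrow> \<alpha> v > 0"
    and "(\<Sum>v\<in>Z. \<alpha> v *\<^sub>R ev v) =
      ev (qcenter f) + quad_of_matrix ((qmu f / CARD('n)) *\<^sub>R matrix_inv (qmat f))"
    using \<open>eutactic f\<close> unfolding eutactic_def Z_def by blast
  then have "w f = (\<Sum>v\<in>Z. \<alpha> v *\<^sub>R ev v)"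
    using qmu_eq_hermite[OF f] by (simp add: w_def hermite_normal_def)
  then have wf: "w f \<bullet> qdual h = (\<Sum>v\<in>Z. \<alpha> v * quad_eval h v)" for h
    by (simp add: inner_sum_left ev_inner_qdual)
  \<comment> \<open>The tangent inequality needs a nonnegative \<open>\<kappa>\<close>. An integer
    zero of \<open>f\<close> provides it, since the minimum is then at most 0.\<close>
  have H: "hermite f \<ge> 0"
  proof -
    have "Z \<noteq> {}"
    proof
      assume "Z = {}"
      \<comment> \<open>Without zeros every quadratic function would be a multiple of
        \<open>f\<close>, but \<open>ev 0\<close> is the constant 1, whose matrix vanishes.\<close>
      then have "\<exists>r. ev x = r *\<^sub>R f" for x by (intro span ev_in_quad_functions) auto
      then obtain r where r: "ev 0 = r *\<^sub>R f" by blast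
      have "qmat (ev 0 :: 'n quad) = r *\<^sub>R qmat f" "qconst (ev 0 :: 'n quad) = r * qconst f"
        unfolding r by simp_all
      moreover have "qmat (ev 0 :: 'n quad) = 0" "qconst (ev 0 :: 'n quad) = 1"
        by (simp_all add: ev_def qmat_def qconst_def vec_eq_iff)
      ultimately have "qmat f = 0" by auto
      then show False using pos_definite_pos[OF f, of "axis undefined 1"] by (auto simp: axis_eq_0_iff)
    qed
    then obtain v where "quad_eval f v = 0" using Z by blast
    then show ?thesis
      using quad_eval_ge_qmu(1)[OF f, of v] root_det_pos[OF f] by (simp add: hermite_root_det)
  qed
  \<comment> \<open>The pairing with \<open>w f\<close>, with absolute values added so that it is
    positive on nonzero \<open>h\<close> of either sign; it agrees with the pairing when
    \<open>h\<close> is nonnegative on \<open>Z\<close>.\<close>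
  define p where "p h = (\<Sum>v\<in>Z. \<alpha> v * \<bar>ev v \<bullet> qdual h\<bar>)" for h
  have blq: "bounded_linear (qdual :: 'n quad \<Rightarrow> 'n quad)"
    using linear_qdual by (simp add: linear_conv_bounded_linear)
  \<comment> \<open>A complement of the line through \<open>f\<close>; orthogonality here is that of
    the product type.\<close>
  define V where "V = {h \<in> quad_functions. h \<bullet> f = 0}"
  have V: "subspace V"
    unfolding V_def by (rule subspace_inner_kernel[OF subspace_quad_functions])
  have "f \<bullet> f > 0"
    using pos_definite_pos[OF f, of "axis undefined 1"] by (auto simp: axis_eq_0_iff)
  have p_cont: "continuous_on UNIV p"
    unfolding p_def
    by (intro continuous_intros bounded_linear.continuous_on[OF blq])
  have p_hom: "p (r *\<^sub>R h) = r * p h" if "r \<ge> 0" for r h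
    using that
    by (simp add: p_def linear_scale[OF linear_qdual] abs_mult sum_distrib_left mult_ac)
  have p_pos: "p h > 0" if h: "h \<in> V" "h \<noteq> 0" for h
  proof (rule ccontr)
    assume "\<not> p h > 0"
    moreover have nonneg: "\<alpha> v * \<bar>ev v \<bullet> qdual h\<bar> \<ge> 0" if "v \<in> Z" for v
      using \<alpha>[OF that] by simp
    ultimately have "p h = 0" unfolding p_def by (meson not_less order_antisym sum_nonneg)
    then have "\<alpha> v * \<bar>ev v \<bullet> qdual h\<bar> = 0" if "v \<in> Z" for v
      using sum_nonneg_eq_0_iff[OF fin nonneg] that by (simp add: p_def)
    then have "quad_eval h v = 0" if "v \<in> Z" for v
      using \<alpha> that by (fastforce simp: ev_inner_qdual)
    then obtain r where "h = r *\<^sub>R f" using span[of h] h(1) by (metis (mono_tags, lifting) V_def mem_Collect_eq)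
    then show False using h \<open>f \<bullet> f > 0\<close> by (auto simp: V_def)
  qed
  obtain d where d: "d > 0" "\<And>h. h \<in> V \<Longrightarrow> d * norm h \<le> p h"
    using homogeneous_lower_bound[OF V p_cont p_hom p_pos] by blast
  obtain B where B: "B > 0" "\<And>h :: 'n quad. norm (qdual h) \<le> B * norm h"
    using bounded_linear.pos_bounded[OF blq] by (metis mult.commute)
  \<comment> \<open>The factor \<open>1 / B\<close> offsets the norm of \<open>qdual\<close>, so
    moving from \<open>w f\<close> to \<open>w g\<close> changes the pairing with \<open>h\<close>
    by at most \<open>d * norm h\<close>.\<close>
  have "\<forall>\<^sub>F g in at f within erdahl_pos. dist (w g) (w f) < d / B"
    using tendsto_hermite_normal[OF f] d(1) B(1) unfolding w_def by (intro tendstoD) auto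
  moreover have "\<forall>\<^sub>F g in at f within erdahl_pos. g \<bullet> f > 0"
  proof (rule order_tendstoD(1)[OF _ \<open>f \<bullet> f > 0\<close>])
    show "((\<lambda>g. g \<bullet> f) \<longlongrightarrow> f \<bullet> f) (at f within erdahl_pos)"
      by (intro tendsto_intros)
  qed
  moreover have "\<forall>\<^sub>F g in at f within erdahl_pos. g \<in> erdahl_pos"
    by (simp add: eventually_at_filter)
  ultimately have "\<forall>\<^sub>F g in at f within erdahl_pos. hermite g \<le> hermite f"
  proof eventually_elim
    case (elim g)
    have g: "pos_definite (qmat g)" using elim(3) by (rule erdahl_posD)
    define t where "t = (g \<bullet> f) / (f \<bullet> f)"
    define h where "h = g - t *\<^sub>R f"
    have t: "t > 0" using elim(2) \<open>f \<bullet> f > 0\<close> by (simp add: t_def)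
    have "h \<bullet> f = 0" using \<open>f \<bullet> f > 0\<close> by (simp add: h_def t_def inner_diff_left)
    moreover have "h \<in> quad_functions"
      unfolding h_def
      by (intro subspace_diff subspace_mul subspace_quad_functions erdahl_posD(1) fE elim)
    ultimately have "h \<in> V" by (simp add: V_def)
    have g_eq: "g = h + t *\<^sub>R f" by (simp add: h_def)
    have hv: "quad_eval h v \<ge> 0" if "v \<in> Z" for v
    proof -
      have "quad_eval g v = quad_eval h v + t * quad_eval f v" unfolding g_eq by simp
      then show ?thesis using that erdahl_posD(3)[OF elim(3), of v] by (simp add: Z)
    qed
    then have "p h = w f \<bullet> qdual h" unfolding p_def wf by (simp add: ev_inner_qdual)
    then have "w f \<bullet> qdual h \<ge> d * norm h" using d(2)[OF \<open>h \<in> V\<close>] by simp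
    moreover have "\<bar>(w g - w f) \<bullet> qdual h\<bar> \<le> d * norm h"
    proof -
      have "\<bar>(w g - w f) \<bullet> qdual h\<bar> \<le> norm (w g - w f) * norm (qdual h)"
        by (rule Cauchy_Schwarz_ineq2)
      also have "\<dots> \<le> d / B * (B * norm h)"
        using elim(1) B d(1) by (intro mult_mono) (auto simp: dist_norm)
      finally show ?thesis using B(1) by simp
    qed
    ultimately have "w g \<bullet> qdual h \<ge> 0" by (simp add: inner_diff_left)
    \<comment> \<open>The tangent inequality based at \<open>g\<close> and read at \<open>f\<close>,
      where the lower bound is 0.\<close>
    moreover have "w g \<bullet> qdual f \<ge> 0"
      using hermite_normal_inner_ge(1)[OF f g H] qmu_eq_hermite[OF f] by (simp add: w_def)
    ultimately have "w g \<bullet> qdual g \<ge> 0"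
      unfolding g_eq using t
      by (simp add: linear_add[OF linear_qdual] linear_scale[OF linear_qdual] inner_add_right)
    then show ?case
      using hermite_normal_inner_self[OF g] by (simp add: w_def hermite_le_iff[OF g])
  qed
  then show ?thesis using fE by (simp add: extreme_def)
qed

text \<open>If \<open>h\<close> vanishes at all integer zeros, both \<open>h\<close> and
  \<open>- h\<close> are admissible directions, and one of them pairs nonpositively with the
  normal.\<close>

lemma extreme_perfect:
  fixes f :: "'n::finite quad"
  assumes "extreme f"
  shows "perfect f"
  unfolding perfect_iff[OF extreme_pos_definite[OF assms]]
proof (intro ballI impI)
  fix h :: "'n quad"
  assume h: "h \<in> quad_functions" and "\<forall>v\<in>vert (Del f). quad_eval h v = 0"
  then have zero: "quad_eval h v = 0" if "v \<in> integer_vectors" "quad_eval f v = 0" for v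
    using that by (simp add: vert_Del[OF extreme_pos_definite[OF assms]])
  let ?w = "hermite_normal (hermite f) f"
  show "\<exists>r. h = r *\<^sub>R f"
  proof (cases "?w \<bullet> qdual h \<le> 0")
    case True
    then show ?thesis using zero by (intro extreme_cone_trivial[OF assms h]) auto
  next
    case False
    have "\<exists>r. (- 1) *\<^sub>R h = r *\<^sub>R f"
    proof (rule extreme_cone_trivial[OF assms])
      show "(- 1) *\<^sub>R h \<in> quad_functions" by (rule subspace_mul[OF subspace_quad_functions h])
      show "?w \<bullet> qdual ((- 1) *\<^sub>R h) \<le> 0"
        using False unfolding linear_scale[OF linear_qdual] by simp
    qed (simp add: zero del: scaleR_minus_left scaleR_minus1_left)
    then obtain r where "- h = r *\<^sub>R f" by auto
    then have "h = (- r) *\<^sub>R f" by (metis minus_minus scaleR_minus_left)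
    then show ?thesis ..
  qed
qed

theorem theorem2p6:
  fixes f :: "'n::finite quad"
  assumes "f \<in> erdahl_pos"
  shows "extreme f \<longleftrightarrow> perfect f \<and> eutactic f"
  using assms extreme_perfect extreme_eutactic perfect_eutactic_extreme by blast

end
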